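(* Let $p$ and $s$ be two positive integers and let $\psi$ be a non-constant radial function. If there exists a non-constant radial function $\phi$ such that $T_{e^{ip\theta}\phi}$ commutes with $T_{e^{-is\theta}\psi}$ on $L^2_h$, then $\phi$ is unique up to a multiplicative constant (that is, if $\phi_1,\phi_2$ are two non-constant radial functions such that both $T_{e^{ip\theta}\phi_1}$ and $T_{e^{ip\theta}\phi_2}$ commute with $T_{e^{-is\theta}\psi}$, then $\phi_1=c\,\phi_2$ for some constant $c$).
   Context: Let $\mathbb{D}$ be the open unit disk in $\mathbb{C}$, with normalized Lebesgue area measure $dA=\frac{1}{\pi}r\,dr\,d\theta$ in polar coordinates $(r,\theta)$. The harmonic Bergman space $L^2_h$ is the closed subspace of $L^2(\mathbb{D},dA)$ consisting of all (complex-valued) harmonic functions on $\mathbb{D}$ belonging to $L^2(\mathbb{D},dA)$. Let $R_z$ denote the reproducing kernel of $L^2_h$ at $z\in\mathbb{D}$. For $f\in L^1(\mathbb{D},dA)$, the Toeplitz operator $T_f$ with symbol $f$ is densely defined on $L^2_h$ by $(T_fu)(z)=\int_{\mathbb{D}}f(w)u(w)R_z(w)\,dA(w)$ for $u$ a harmonic polynomial (a finite linear combination of $z^n,\bar z^n$, $n\ge 0$). If $f$ is bounded, then $T_fu=Q(fu)$, where $Q$ is the orthogonal projection of $L^2(\mathbb{D},dA)$ onto $L^2_h$. Standing assumption: all symbols considered belong to $L^1(\mathbb{D},dA)$ and are such that the Toeplitz operator so defined extends to a bounded operator on $L^2_h$; $T_f$ denotes this extension. A radial function $\phi$ on $\mathbb{D}$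 is one depending only on $r=|z|$; it is identified with a function on $[0,1)$ (an element of $L^1([0,1],r\,dr)$), and functions are identified when equal almost everywhere. For an integer $p$, $e^{ip\theta}\phi$ denotes the symbol $re^{i\theta}\mapsto e^{ip\theta}\phi(r)$. Two bounded operators $S,T$ commute if $ST=TS$. *)

theory Defs
  imports "HOL-Analysis.Analysis"
begin

abbreviation unit_disc :: "complex set" where
  "unit_disc \<equiv> ball 0 1"

definition disc_measure :: "complex measure" where
  "disc_measure = density (lebesgue_on unit_disc) (\<lambda>_. ennreal (1 / pi))"

definition dx :: "(complex \<Rightarrow> complex) \<Rightarrow> complex \<Rightarrow> complex" where
  "dx u z = frechet_derivative u (at z) 1"

definition dy :: "(complex \<Rightarrow> complex) \<Rightarrow> complex \<Rightarrow> complex" where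
  "dy u z = frechet_derivative u (at z) \<i>"

text \<open>Complex-valued harmonic functions on an open set, i.e. functions of class \<open>C\<^sup>2\<close> in the
  real sense whose Laplacian vanishes. Differentiability here is over the reals.\<close>

definition harmonic_on :: "(complex \<Rightarrow> complex) \<Rightarrow> complex set \<Rightarrow> bool" where
  "harmonic_on u S \<longleftrightarrow>
     (\<forall>z\<in>S. u differentiable (at z) \<and> dx u differentiable (at z) \<and> dy u differentiable (at z)) \<and>
     continuous_on S (dx (dx u)) \<and> continuous_on S (dy (dx u)) \<and>
     continuous_on S (dx (dy u)) \<and> continuous_on S (dy (dy u)) \<and>
     (\<forall>z\<in>S. dx (dx u) z + dy (dy u) z = 0)"

text \<open>The harmonic Bergman space. Two harmonic functions that agree almost everywhere on the disc
  agree everywhere on it, so classes modulo null sets are represented by functions on the disc;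
  these are extended by \<open>0\<close>, so that equality in the space is equality of HOL functions.\<close>

definition harmonic_bergman :: "(complex \<Rightarrow> complex) set" where
  "harmonic_bergman =
     {u. harmonic_on u unit_disc \<and> (\<forall>z. z \<notin> unit_disc \<longrightarrow> u z = 0) \<and>
         integrable disc_measure (\<lambda>z. (cmod (u z))\<^sup>2)}"

definition inner_L2 :: "(complex \<Rightarrow> complex) \<Rightarrow> (complex \<Rightarrow> complex) \<Rightarrow> complex" where
  "inner_L2 u v = (LINT w|disc_measure. u w * cnj (v w))"

definition norm_L2 :: "(complex \<Rightarrow> complex) \<Rightarrow> real" where
  "norm_L2 u = sqrt (LINT w|disc_measure. (cmod (u w))\<^sup>2)"

definition repr_kernel :: "complex \<Rightarrow> complex \<Rightarrow> complex" where
  "repr_kernel z =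
     (THE k. k \<in> harmonic_bergman \<and> (\<forall>u\<in>harmonic_bergman. u z = inner_L2 u k))"

definition harmonic_poly :: "(complex \<Rightarrow> complex) set" where
  "harmonic_poly =
     {u. \<exists>(N::nat) a b. u = (\<lambda>z. if z \<in> unit_disc then \<Sum>n\<le>N. a n * z ^ n + b n * cnj z ^ n else 0)}"

definition toeplitz_poly :: "(complex \<Rightarrow> complex) \<Rightarrow> (complex \<Rightarrow> complex) \<Rightarrow> complex \<Rightarrow> complex" where
  "toeplitz_poly f u =
     (\<lambda>z. if z \<in> unit_disc then LINT w|disc_measure. f w * u w * repr_kernel z w else 0)"

definition bounded_operator :: "((complex \<Rightarrow> complex) \<Rightarrow> (complex \<Rightarrow> complex)) \<Rightarrow> bool" where
  "bounded_operator T \<longleftrightarrow>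
     (\<forall>u\<in>harmonic_bergman. T u \<in> harmonic_bergman) \<and>
     (\<forall>u\<in>harmonic_bergman. \<forall>v\<in>harmonic_bergman. \<forall>a b.
        T (\<lambda>z. a * u z + b * v z) = (\<lambda>z. a * T u z + b * T v z)) \<and>
     (\<exists>C. \<forall>u\<in>harmonic_bergman. norm_L2 (T u) \<le> C * norm_L2 u)"

definition bounded_extension ::
    "(complex \<Rightarrow> complex) \<Rightarrow> ((complex \<Rightarrow> complex) \<Rightarrow> (complex \<Rightarrow> complex)) \<Rightarrow> bool" where
  "bounded_extension f T \<longleftrightarrow>
     bounded_operator T \<and> (\<forall>u\<in>harmonic_poly. T u = toeplitz_poly f u)"

definition toeplitz_symbol :: "(complex \<Rightarrow> complex) \<Rightarrow> bool" where
  "toeplitz_symbol f \<longleftrightarrow> integrable disc_measure f \<and> (\<exists>T. bounded_extension f T)"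

text \<open>Harmonic polynomials are dense in the harmonic Bergman space, so the bounded extension is
  unique there; only the irrelevant values off the space depend on the choice.\<close>

definition toeplitz :: "(complex \<Rightarrow> complex) \<Rightarrow> (complex \<Rightarrow> complex) \<Rightarrow> (complex \<Rightarrow> complex)" where
  "toeplitz f = (SOME T. bounded_extension f T)"

definition commuting ::
    "((complex \<Rightarrow> complex) \<Rightarrow> (complex \<Rightarrow> complex)) \<Rightarrow>
     ((complex \<Rightarrow> complex) \<Rightarrow> (complex \<Rightarrow> complex)) \<Rightarrow> bool" where
  "commuting S T \<longleftrightarrow> (\<forall>u\<in>harmonic_bergman. S (T u) = T (S u))"

text \<open>The symbol \<open>r e\<^sup>i\<^sup>\<theta> \<mapsto> e\<^sup>i\<^sup>k\<^sup>\<theta> \<phi>(r)\<close>.\<close>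

definition quasihom :: "int \<Rightarrow> (real \<Rightarrow> complex) \<Rightarrow> complex \<Rightarrow> complex" where
  "quasihom k \<phi> z = cis (of_int k * Arg z) * \<phi> (cmod z)"

definition radial_function :: "(real \<Rightarrow> complex) \<Rightarrow> bool" where
  "radial_function \<phi> \<longleftrightarrow> integrable (lebesgue_on {0..<1}) (\<lambda>r. of_real r * \<phi> r)"

definition nonconstant_radial :: "(real \<Rightarrow> complex) \<Rightarrow> bool" where
  "nonconstant_radial \<phi> \<longleftrightarrow>
     radial_function \<phi> \<and> \<not> (\<exists>c. AE r in lebesgue_on {0..<1}. \<phi> r = c)"

end

theory Submission
  imports Defs "HOL-Complex_Analysis.Complex_Analysis"
begin

text \<open>
  Write \<open>M\<close> for the Mellin transform of radial functions with respect to \<open>2 r dr\<close> on \<open>[0, 1)\<close>. The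
  reproducing kernel of the harmonic Bergman space is
  \<open>R z w = 1 / (1 - z cnj w)\<^sup>2 + 1 / (1 - cnj z w)\<^sup>2 - 1\<close>, so the Toeplitz operator of a quasihomogeneous
  symbol of degree \<open>k\<close> maps \<open>z\<^sup>m\<close> to \<open>(k + m + 1) M \<phi> (2 m + k) z\<^sup>k\<^sup>+\<^sup>m\<close>. Evaluated on \<open>z\<^sup>j\<^sup>+\<^sup>s\<close>,
  commutation says
  \<open>(j + 1) M \<psi> (2 j + s) M \<phi> (2 j + p) = (j + s + p + 1) M \<phi> (2 j + 2 s + p) M \<psi> (2 j + 2 p + s)\<close>.
  Divided by the two linear factors, both sides become moments of complex measures on \<open>[0, 1]\<close>, so by
  Weierstrass approximation the identity holds for all real \<open>j > 0\<close>. Mellin transforms are holomorphic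
  in a half-plane and have countably many zeros; starting from a real \<open>j\<close> whose translates avoid all
  of them, the identity makes \<open>M \<phi>\<^sub>1\<close> proportional to \<open>M \<phi>\<^sub>2\<close> along an arithmetic progression, which
  determines the functions almost everywhere.
\<close>

section \<open>Area measure on the disc\<close>

text \<open>Commutation yields identities only at integers \<open>j\<close>, and there the recursion
  behind uniqueness may break down: a transform by which it has to divide may vanish at an integer.
  Real \<open>j\<close> offers an escape, since a countable set of zeros is missed by a suitable
  shift. The linear factors are unbounded in \<open>j\<close>, so they must be turned into
  transforms before Weierstrass approximation applies. The test vectors are powers of degree at
  least \<open>s\<close>: lowering the degree by \<open>s\<close> then leaves them holomorphic, so
  that the antiholomorphic half of the kernel contributes only to constants, where the term
  \<open>-1\<close> removes it. No change to polar coordinates is made. Two facts about area replace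
  it: rotation invariance, by which every quasihomogeneous function of nonzero degree has integral
  \<open>0\<close>, and the distribution of the modulus, which has density \<open>2 * r\<close>. The
  symbols are only Lebesgue measurable and are replaced by Borel representatives before image
  measures are used.\<close>

lemma measurable_Complex_pair [measurable]:
  "(\<lambda>(x, y). Complex x y) \<in> borel_measurable (borel \<Otimes>\<^sub>M borel)"
proof -
  have "continuous_on UNIV (\<lambda>q::real \<times> real. Complex (fst q) (snd q))"
    by (intro continuous_intros)
  then have "(\<lambda>q::real \<times> real. Complex (fst q) (snd q)) \<in> borel_measurable borel"
    by (rule borel_measurable_continuous_onI)
  then show ?thesis
    by (simp add: borel_prod case_prod_beta)
qed

text \<open>Lebesgue measure is determined by its values on boxes, and a box in
  \<open>complex\<close> pulls back to a product of two intervals. This opens the plane to iterated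
  integration.\<close>

lemma lborel_complex_eq_distr:
  "(lborel :: complex measure) = distr (lborel \<Otimes>\<^sub>M lborel) borel (\<lambda>(x, y). Complex x y)"
proof (rule lborel_eqI)
  fix l u :: complex
  assume le: "\<And>b. b \<in> Basis \<Longrightarrow> l \<bullet> b \<le> u \<bullet> b"
  have le': "Re l \<le> Re u" "Im l \<le> Im u"
    using le[of 1] le[of \<i>] by (auto simp: Basis_complex_def inner_complex_def)
  have "(\<lambda>(x, y). Complex x y) -` box l u \<inter> space (lborel \<Otimes>\<^sub>M lborel) = box (Re l) (Re u) \<times> box (Im l) (Im u)"
    by (auto simp: box_def Basis_complex_def inner_complex_def space_pair_measure)
  then have "emeasure (distr (lborel \<Otimes>\<^sub>M lborel) borel (\<lambda>(x, y). Complex x y)) (box l u)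
      = emeasure (lborel \<Otimes>\<^sub>M lborel) (box (Re l) (Re u) \<times> box (Im l) (Im u))"
    by (subst emeasure_distr) (auto simp: measurable_Complex_pair)
  also have "\<dots> = emeasure lborel (box (Re l) (Re u)) * emeasure lborel (box (Im l) (Im u))"
    by (subst lborel.emeasure_pair_measure_Times) auto
  also have "\<dots> = (\<Prod>b\<in>Basis. (u - l) \<bullet> b)"
    using le' by (simp add: Basis_complex_def inner_complex_def ennreal_mult' box_real)
  finally show "emeasure (distr (lborel \<Otimes>\<^sub>M lborel) borel (\<lambda>(x, y). Complex x y)) (box l u)
      = (\<Prod>b\<in>Basis. (u - l) \<bullet> b)" .
qed auto

text \<open>On each horizontal line the shear is a translation, because the imaginary part is fixed
  there; Tonelli reduces the claim to translation invariance on the real line.\<close>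

lemma nn_integral_complex_shear:
  fixes f :: "complex \<Rightarrow> ennreal"
  assumes f [measurable]: "f \<in> borel_measurable borel"
  shows "(\<integral>\<^sup>+z. f (z + of_real (t * Im z)) \<partial>lborel) = (\<integral>\<^sup>+z. f z \<partial>lborel)"
proof -
  have iter: "(\<integral>\<^sup>+z. g z \<partial>lborel) = (\<integral>\<^sup>+y. \<integral>\<^sup>+x. g (Complex x y) \<partial>lborel \<partial>lborel)"
    if g [measurable]: "g \<in> borel_measurable borel" for g :: "complex \<Rightarrow> ennreal"
  proof -
    have "(\<integral>\<^sup>+z. g z \<partial>lborel) = (\<integral>\<^sup>+q. g (case q of (x, y) \<Rightarrow> Complex x y) \<partial>(lborel \<Otimes>\<^sub>M lborel))"
      by (subst lborel_complex_eq_distr, subst nn_integral_distr) auto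
    also have "\<dots> = (\<integral>\<^sup>+y. \<integral>\<^sup>+x. g (case (x, y) of (x, y) \<Rightarrow> Complex x y) \<partial>lborel \<partial>lborel)"
      by (subst lborel_pair.nn_integral_snd[symmetric]) auto
    finally show ?thesis by simp
  qed
  have "(\<integral>\<^sup>+z. f (z + of_real (t * Im z)) \<partial>lborel)
      = (\<integral>\<^sup>+y. \<integral>\<^sup>+x. f (Complex x y + of_real (t * y)) \<partial>lborel \<partial>lborel)"
    by (subst iter) auto
  also have "\<dots> = (\<integral>\<^sup>+y. \<integral>\<^sup>+x. f (Complex x y) \<partial>lborel \<partial>lborel)"
  proof (rule nn_integral_cong)
    fix y :: real
    have m: "(\<lambda>x. f (Complex x y)) \<in> borel_measurable borel"
      by (rule measurable_compose[OF _ f])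
         (intro borel_measurable_continuous_onI continuous_intros)
    have "(\<integral>\<^sup>+x. f (Complex x y + of_real (t * y)) \<partial>lborel)
        = (\<integral>\<^sup>+x. f (Complex (t * y + 1 * x) y) \<partial>lborel)"
      by (intro nn_integral_cong arg_cong[where f = f]) (simp add: complex_eq_iff)
    also have "\<dots> = (\<integral>\<^sup>+x. f (Complex x y) \<partial>lborel)"
      using nn_integral_real_affine[OF m, of 1 "t * y"] by simp
    finally show "(\<integral>\<^sup>+x. f (Complex x y + of_real (t * y)) \<partial>lborel)
        = (\<integral>\<^sup>+x. f (Complex x y) \<partial>lborel)" .
  qed
  also have "\<dots> = (\<integral>\<^sup>+z. f z \<partial>lborel)"
    by (subst iter) auto
  finally show ?thesis .
qed

text \<open>The map sends \<open>x + \<i> * y\<close> to \<open>y + \<i> * x\<close>, so the claim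
  is the freedom to choose the order of integration. Conjugation by it turns horizontal shears into
  vertical ones.\<close>

lemma nn_integral_complex_swap:
  fixes f :: "complex \<Rightarrow> ennreal"
  assumes f [measurable]: "f \<in> borel_measurable borel"
  shows "(\<integral>\<^sup>+z. f (\<i> * cnj z) \<partial>lborel) = (\<integral>\<^sup>+z. f z \<partial>lborel)"
proof -
  have m: "(\<lambda>z. f (\<i> * cnj z)) \<in> borel_measurable borel"
    by (rule measurable_compose[OF _ f]) (intro borel_measurable_continuous_onI continuous_intros)
  have "(\<integral>\<^sup>+z. f (\<i> * cnj z) \<partial>lborel)
      = (\<integral>\<^sup>+q. f (\<i> * cnj (case q of (x, y) \<Rightarrow> Complex x y)) \<partial>(lborel \<Otimes>\<^sub>M lborel))"
    by (subst lborel_complex_eq_distr, subst nn_integral_distr) (auto simp: m)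
  also have "\<dots> = (\<integral>\<^sup>+y. \<integral>\<^sup>+x. f (\<i> * cnj (case (x, y) of (x, y) \<Rightarrow> Complex x y)) \<partial>lborel \<partial>lborel)"
    by (subst lborel_pair.nn_integral_snd[symmetric]) (auto intro!: measurable_compose[OF _ m])
  also have "\<dots> = (\<integral>\<^sup>+y. \<integral>\<^sup>+x. f (case (y, x) of (x, y) \<Rightarrow> Complex x y) \<partial>lborel \<partial>lborel)"
    by (intro nn_integral_cong arg_cong[where f = f]) (simp add: complex_eq_iff)
  also have "\<dots> = (\<integral>\<^sup>+q. f (case q of (x, y) \<Rightarrow> Complex x y) \<partial>(lborel \<Otimes>\<^sub>M lborel))"
    by (subst lborel.nn_integral_fst) auto
  also have "\<dots> = (\<integral>\<^sup>+z. f z \<partial>lborel)"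
    by (subst lborel_complex_eq_distr, subst nn_integral_distr) auto
  finally show ?thesis .
qed

text \<open>A rotation by an angle other than \<open>\<pi>\<close> is a product of three shears.\<close>

lemma nn_integral_complex_rotation:
  fixes f :: "complex \<Rightarrow> ennreal"
  assumes f [measurable]: "f \<in> borel_measurable borel" and "cos (\<alpha> / 2) \<noteq> 0"
  shows "(\<integral>\<^sup>+z. f (cis \<alpha> * z) \<partial>lborel) = (\<integral>\<^sup>+z. f z \<partial>lborel)"
proof -
  \<comment> \<open>The rotation by \<alpha> is a horizontal shear by
    \<open>- tan (\<alpha> / 2)\<close>, then a vertical shear by \<open>sin \<alpha>\<close>, then
    the first shear again. The vertical one is written as \<open>W\<close>, \<open>Y\<close>,
    \<open>W\<close>. The tangent is why \<open>cos (\<alpha> / 2)\<close> must not vanish.\<close>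
  define t where "t = - tan (\<alpha> / 2)"
  define \<sigma> where "\<sigma> = sin \<alpha>"
  define X where "X = (\<lambda>z. z + complex_of_real (t * Im z))"
  define Y where "Y = (\<lambda>z. z + complex_of_real (\<sigma> * Im z))"
  define W where "W = (\<lambda>z. \<i> * cnj z)"
  have m [measurable]: "X \<in> borel_measurable borel" "Y \<in> borel_measurable borel" "W \<in> borel_measurable borel"
    by (auto simp: X_def Y_def W_def intro!: borel_measurable_continuous_onI continuous_intros)
  have W: "\<i> * cnj z = W z" for z by (simp add: W_def)
  have a: "\<alpha> = 2 * (\<alpha> / 2)" by simp
  have s: "\<sigma> = 2 * sin (\<alpha>/2) * cos (\<alpha>/2)"
    unfolding \<sigma>_def by (subst a, subst sin_double) simp
  have "cos \<alpha> = 1 - 2 * sin (\<alpha>/2) ^ 2"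
    by (subst a, subst cos_double_sin) simp
  then have c: "cos \<alpha> = 1 + t * \<sigma>"
    using assms(2) unfolding t_def s by (simp add: tan_def power2_eq_square)
  have tc: "t * (1 + cos \<alpha>) = - \<sigma>"
  proof -
    have "cos \<alpha> = 2 * cos (\<alpha>/2) ^ 2 - 1"
      by (subst a, subst cos_double_cos) simp
    then show ?thesis
      using assms(2) unfolding t_def s by (simp add: tan_def power2_eq_square)
  qed
  have e: "cis \<alpha> * z = X (W (Y (W (X z))))" for z
  proof -
    have "t * \<sigma> + (1 + t * \<sigma>) = cos \<alpha> + t * \<sigma>" using c by simp
    have "t + t * cos \<alpha> = - \<sigma>" using tc by (simp add: algebra_simps)
    then have "t + t * (1 + t * \<sigma>) = - \<sigma>" by (simp only: c)
    then have k: "(t + t * (1 + t * \<sigma>)) * Im z = - \<sigma> * Im z" by simp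
    show ?thesis
      using k by (auto simp: X_def Y_def W_def complex_eq_iff c \<sigma>_def[symmetric] algebra_simps)
  qed
  have "(\<integral>\<^sup>+z. f (cis \<alpha> * z) \<partial>lborel) = (\<integral>\<^sup>+z. f (X (W (Y (W (X z))))) \<partial>lborel)"
    by (simp add: e)
  also have "\<dots> = (\<integral>\<^sup>+z. f (X (W (Y (W z)))) \<partial>lborel)"
    using nn_integral_complex_shear[of "\<lambda>z. f (X (W (Y (W z))))" t] by (simp add: X_def)
  also have "\<dots> = (\<integral>\<^sup>+z. f (X (W (Y z))) \<partial>lborel)"
    using nn_integral_complex_swap[of "\<lambda>z. f (X (W (Y z)))"] unfolding W by simp
  also have "\<dots> = (\<integral>\<^sup>+z. f (X (W z)) \<partial>lborel)"
    using nn_integral_complex_shear[of "\<lambda>z. f (X (W z))" \<sigma>] by (simp add: Y_def)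
  also have "\<dots> = (\<integral>\<^sup>+z. f (X z) \<partial>lborel)"
    using nn_integral_complex_swap[of "\<lambda>z. f (X z)"] unfolding W by simp
  also have "\<dots> = (\<integral>\<^sup>+z. f z \<partial>lborel)"
    using nn_integral_complex_shear[of f t] by (simp add: X_def)
  finally show ?thesis .
qed

section \<open>Integration over the disc and its rotation invariance\<close>

lemma space_disc_measure [simp]: "space disc_measure = unit_disc"
  by (simp add: disc_measure_def)

lemma borel_measurable_disc_measure [measurable (raw)]:
  assumes "f \<in> borel_measurable borel"
  shows "f \<in> borel_measurable disc_measure"
proof -
  have "f \<in> borel_measurable lborel" using assms by simp
  then have "f \<in> borel_measurable lebesgue" by (rule measurable_completion)
  then show ?thesis
    by (simp add: disc_measure_def measurable_density_eq1 measurable_restrict_space1)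
qed

lemma borel_measurable_indicator_ball [measurable, simp]:
  "indicator (ball (a::complex) x) \<in> borel_measurable borel"
  "indicator (cball (a::complex) x) \<in> borel_measurable borel"
  by (auto intro!: borel_measurable_indicator)

text \<open>\<open>disc_measure\<close> is built on the completed sigma-algebra, whereas shears and
  rotations are handled over \<open>lborel\<close>. On Borel integrands completion leaves
  nonnegative integrals unchanged, which links the two.\<close>

lemma nn_integral_disc_measure:
  fixes f :: "complex \<Rightarrow> ennreal"
  assumes f [measurable]: "f \<in> borel_measurable borel"
  shows "(\<integral>\<^sup>+z. f z \<partial>disc_measure) = ennreal (1 / pi) * (\<integral>\<^sup>+z. f z * indicator unit_disc z \<partial>lborel)"
proof -
  have m: "f \<in> borel_measurable lebesgue"
    using f by (intro measurable_completion) simp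
  have "(\<integral>\<^sup>+z. f z \<partial>disc_measure) = (\<integral>\<^sup>+z. ennreal (1 / pi) * f z \<partial>lebesgue_on unit_disc)"
    unfolding disc_measure_def
    by (subst nn_integral_density) (auto intro!: measurable_restrict_space1 m)
  also have "\<dots> = (\<integral>\<^sup>+z. ennreal (1 / pi) * f z * indicator unit_disc z \<partial>lebesgue)"
    by (subst nn_integral_restrict_space) auto
  also have "\<dots> = (\<integral>\<^sup>+z. ennreal (1 / pi) * f z * indicator unit_disc z \<partial>lborel)"
    by (rule nn_integral_completion)
  also have "\<dots> = ennreal (1 / pi) * (\<integral>\<^sup>+z. f z * indicator unit_disc z \<partial>lborel)"
    by (subst nn_integral_cmult[symmetric]) (auto simp: mult_ac)
  finally show ?thesis .
qed

lemma emeasure_disc_measure_ball: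
  assumes "0 \<le> x" "x \<le> 1"
  shows "emeasure disc_measure (ball 0 x) = ennreal (x\<^sup>2)"
proof -
  have i: "ball 0 x \<in> sets disc_measure"
    using assms by (auto simp: disc_measure_def sets_restrict_space_iff)
  have "emeasure disc_measure (ball 0 x) = (\<integral>\<^sup>+z. indicator (ball 0 x) z \<partial>disc_measure)"
    using i by simp
  also have "\<dots> = ennreal (1 / pi) * (\<integral>\<^sup>+z. indicator (ball 0 x) z * indicator unit_disc z \<partial>(lborel::complex measure))"
    by (rule nn_integral_disc_measure) auto
  also have "(\<lambda>z. indicator (ball 0 x) z * indicator unit_disc z) = (indicator (ball (0::complex) x) :: _ \<Rightarrow> ennreal)"
    using assms by (auto simp: indicator_def fun_eq_iff)
  also have "(\<integral>\<^sup>+z. indicator (ball (0::complex) x) z \<partial>lborel) = ennreal (pi * x\<^sup>2)"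
    using assms emeasure_ball[of x "0::complex"]
    by (simp add: unit_ball_vol_2)
  also have "ennreal (1 / pi) * ennreal (pi * x\<^sup>2) = ennreal (x\<^sup>2)"
    by (subst ennreal_mult'[symmetric]) auto
  finally show ?thesis .
qed

lemma emeasure_disc_measure_UNIV [simp]: "emeasure disc_measure unit_disc = 1"
  using emeasure_disc_measure_ball[of 1] by simp

interpretation disc: finite_measure disc_measure
  by standard simp

lemma AE_disc_measure_nonzero: "AE z in disc_measure. z \<noteq> 0"
proof -
  have "AE z in lebesgue_on unit_disc. z \<noteq> (0::complex)"
    using AE_completion[OF AE_lborel_singleton[of "0::complex"]]
    by (subst AE_restrict_space_iff) auto
  then show ?thesis
    unfolding disc_measure_def by (subst AE_density) auto
qed

text \<open>The disc is itself invariant under rotation, so invariance of planar measure passes to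
  it. Both image measures are taken on the Borel sets, which spares any discussion of rotated
  Lebesgue sets.\<close>

lemma distr_disc_measure_rotation:
  assumes "cos (\<alpha> / 2) \<noteq> 0"
  shows "distr disc_measure borel (\<lambda>z. cis \<alpha> * z) = distr disc_measure borel (\<lambda>z. z)"
proof (rule measure_eqI)
  fix A assume "A \<in> sets (distr disc_measure borel (\<lambda>z. cis \<alpha> * z))"
  then have A [measurable]: "A \<in> sets borel" by simp
  have n: "(\<lambda>z. g (cis \<alpha> * z)) \<in> borel_measurable borel" if g: "g \<in> borel_measurable borel" for g :: "complex \<Rightarrow> ennreal"
    by (rule measurable_compose[OF _ g]) (intro borel_measurable_continuous_onI continuous_intros)
  have r: "(\<lambda>z. cis \<alpha> * z) \<in> borel_measurable disc_measure"
    by (intro borel_measurable_disc_measure borel_measurable_continuous_onI continuous_intros)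
  have "emeasure (distr disc_measure borel (\<lambda>z. cis \<alpha> * z)) A
      = (\<integral>\<^sup>+z. indicator A z \<partial>distr disc_measure borel (\<lambda>z. cis \<alpha> * z))"
    by simp
  also have "\<dots> = (\<integral>\<^sup>+z. indicator A (cis \<alpha> * z) \<partial>disc_measure)"
    by (rule nn_integral_distr[OF r]) simp
  also have "\<dots> = ennreal (1 / pi) * (\<integral>\<^sup>+z. indicator A (cis \<alpha> * z) * indicator unit_disc (cis \<alpha> * z) \<partial>lborel)"
    by (subst nn_integral_disc_measure) (auto intro!: n simp: indicator_def norm_mult)
  also have "\<dots> = ennreal (1 / pi) * (\<integral>\<^sup>+z. indicator A z * indicator unit_disc z \<partial>lborel)"
    using nn_integral_complex_rotation[of "\<lambda>z. indicator A z * indicator unit_disc z", OF _ assms]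
      A borel_measurable_indicator_ball(1)[of 0 1] by simp
  also have "\<dots> = (\<integral>\<^sup>+z. indicator A z \<partial>disc_measure)"
    by (subst nn_integral_disc_measure) auto
  also have "\<dots> = (\<integral>\<^sup>+z. indicator A z \<partial>distr disc_measure borel (\<lambda>z. z))"
    by (rule nn_integral_distr[symmetric]) (auto intro: borel_measurable_disc_measure)
  also have "\<dots> = emeasure (distr disc_measure borel (\<lambda>z. z)) A"
    by simp
  finally show "emeasure (distr disc_measure borel (\<lambda>z. cis \<alpha> * z)) A = emeasure (distr disc_measure borel (\<lambda>z. z)) A" .
qed simp

lemma disc_integral_rotation:
  fixes f :: "complex \<Rightarrow> complex"
  assumes f: "f \<in> borel_measurable borel" and "cos (\<alpha> / 2) \<noteq> 0"
  shows "(LINT z|disc_measure. f (cis \<alpha> * z)) = (LINT z|disc_measure. f z)"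
proof -
  have r: "(\<lambda>z. cis \<alpha> * z) \<in> borel_measurable disc_measure"
    by (intro borel_measurable_disc_measure borel_measurable_continuous_onI continuous_intros)
  have "(LINT z|disc_measure. f (cis \<alpha> * z)) = (LINT z|distr disc_measure borel (\<lambda>z. cis \<alpha> * z). f z)"
    by (rule integral_distr[symmetric, OF r f])
  also have "\<dots> = (LINT z|disc_measure. f z)"
    unfolding distr_disc_measure_rotation[OF assms(2)]
    by (rule integral_distr) (auto intro: f borel_measurable_disc_measure)
  finally show ?thesis .
qed

text \<open>Rotating the variable multiplies the integral by
  \<open>cis (of_int d * \<alpha>)\<close> and leaves it unchanged; one angle at which this factor
  differs from \<open>1\<close> suffices. The origin is exempt from the covariance because
  \<open>Arg\<close> is a mere convention there.\<close>

lemma disc_integral_eq_0: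
  fixes f :: "complex \<Rightarrow> complex" and d :: int
  assumes f: "f \<in> borel_measurable borel" and "d \<noteq> 0"
    and eq: "\<And>\<alpha> z. z \<noteq> 0 \<Longrightarrow> f (cis \<alpha> * z) = cis (of_int d * \<alpha>) * f z"
  shows "(LINT z|disc_measure. f z) = 0"
proof -
  \<comment> \<open>This angle makes the factor \<open>\<i>\<close> or \<open>- \<i>\<close>, and it
    is at most \<open>pi / 2\<close>, within the range where invariance under rotation is
    available.\<close>
  define \<alpha> where "\<alpha> = pi / (2 * of_int \<bar>d\<bar>)"
  have "1 \<le> \<bar>d\<bar>" using assms(2) by simp
  then have d1: "1 \<le> real_of_int \<bar>d\<bar>" by linarith
  then have "\<alpha> \<le> pi / 2" "0 \<le> \<alpha>"
    unfolding \<alpha>_def by (auto intro!: divide_left_mono mult_pos_pos simp: divide_le_eq)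
  then have c: "cos (\<alpha> / 2) \<noteq> 0"
    using cos_gt_zero_pi[of "\<alpha>/2"] pi_gt_zero by auto
  have "of_int d * \<alpha> = pi / 2 \<or> of_int d * \<alpha> = - (pi / 2)"
    using assms(2) by (cases "d \<ge> 0") (auto simp: \<alpha>_def field_simps)
  then have ne: "cis (of_int d * \<alpha>) \<noteq> 1"
    by (metis cis.simps(1) cos_minus cos_pi_half one_complex.simps(1) zero_neq_one)
  have "(LINT z|disc_measure. f z) = (LINT z|disc_measure. f (cis \<alpha> * z))"
    by (rule disc_integral_rotation[OF f c, symmetric])
  also have "\<dots> = (LINT z|disc_measure. cis (of_int d * \<alpha>) * f z)"
  proof (rule integral_cong_AE)
    show "AE z in disc_measure. f (cis \<alpha> * z) = cis (of_int d * \<alpha>) * f z"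
      using AE_disc_measure_nonzero by eventually_elim (rule eq)
    show "(\<lambda>z. f (cis \<alpha> * z)) \<in> borel_measurable disc_measure"
      by (intro borel_measurable_disc_measure measurable_compose[OF _ f])
         (intro borel_measurable_continuous_onI continuous_intros)
    show "(\<lambda>z. cis (of_int d * \<alpha>) * f z) \<in> borel_measurable disc_measure"
      using f by (intro borel_measurable_disc_measure) auto
  qed
  also have "\<dots> = cis (of_int d * \<alpha>) * (LINT z|disc_measure. f z)"
    by (rule integral_mult_right_zero)
  finally have "(1 - cis (of_int d * \<alpha>)) * (LINT z|disc_measure. f z) = 0"
    by (simp add: algebra_simps)
  with ne show ?thesis by simp
qed

section \<open>Distribution of the modulus, in place of polar coordinates\<close>

definition radius_measure :: "real measure" where
  "radius_measure = distr disc_measure borel cmod"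

lemma measurable_cmod_disc [measurable]: "cmod \<in> borel_measurable disc_measure"
  by (rule borel_measurable_disc_measure) simp

lemma sets_radius_measure [simp, measurable_cong]: "sets radius_measure = sets borel"
  by (simp add: radius_measure_def)

lemma space_radius_measure [simp]: "space radius_measure = UNIV"
  by (simp add: radius_measure_def)

interpretation radius: finite_measure radius_measure
  unfolding radius_measure_def by (rule disc.finite_measure_distr) simp

text \<open>Finite measures on the line agree once they agree on half-lines. For \<open>x\<close>
  between \<open>0\<close> and \<open>1\<close> both sides give \<open>1 - x\<^sup>2\<close>: on the
  left as the area outside the closed disc of radius \<open>x\<close>, on the right by the
  antiderivative \<open>r\<^sup>2\<close>.\<close>

lemma radius_measure_eq_density:
  "radius_measure = density lborel (\<lambda>r. ennreal (2 * r) * indicator {0..1} r)"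
proof (rule measure_eqI_lessThan)
  fix x :: real
  have [measurable]: "(\<lambda>r. ennreal (2 * r) * indicator {0..1} r) \<in> borel_measurable borel" by measurable
  show "emeasure radius_measure {x<..} < \<infinity>"
    by (simp add: less_top[symmetric])
  have U: "{z \<in> unit_disc. x < cmod z} \<in> sets disc_measure"
    using measurable_sets[OF measurable_cmod_disc, of "{x<..}"] by (simp add: vimage_def Int_def conj_commute)
  have L: "emeasure radius_measure {x<..} = emeasure disc_measure {z \<in> unit_disc. x < cmod z}"
    unfolding radius_measure_def
    by (subst emeasure_distr) (auto intro!: arg_cong[where f = "emeasure disc_measure"])
  have R: "emeasure (density lborel (\<lambda>r. ennreal (2 * r) * indicator {0..1} r)) {x<..}
      = (\<integral>\<^sup>+r. ennreal (2 * r) * indicator {max x 0..1} r \<partial>lborel)"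
  proof (subst emeasure_density)
    show "(\<integral>\<^sup>+ r. ennreal (2 * r) * indicator {0..1} r * indicator {x<..} r \<partial>lborel) =
      (\<integral>\<^sup>+ r. ennreal (2 * r) * indicator {max x 0..1} r \<partial>lborel)"
      by (rule nn_integral_cong_AE, rule AE_mp[OF AE_lborel_singleton[of x]])
         (auto simp: indicator_def)
  qed auto
  have R': "(\<integral>\<^sup>+r. ennreal (2 * r) * indicator {max x 0..1} r \<partial>lborel) = ennreal (1 - (max x 0)\<^sup>2)" if "x \<le> 1"
  proof -
    have "((\<lambda>r. r\<^sup>2) has_real_derivative 2 * r) (at r)" for r :: real
      by (auto intro!: derivative_eq_intros)
    then show ?thesis
      using nn_integral_FTC_Icc[of "\<lambda>r. 2 * r" "max x 0" 1 "\<lambda>r. r\<^sup>2"] that by simp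
  qed
  show "emeasure radius_measure {x<..} = emeasure (density lborel (\<lambda>r. ennreal (2 * r) * indicator {0..1} r)) {x<..}"
  proof (cases "x < 0")
    case True
    then have "{z \<in> unit_disc. x < cmod z} = unit_disc"
      by (auto intro: order_less_le_trans)
    then have "emeasure disc_measure {z \<in> unit_disc. x < cmod z} = 1" by simp
    then show ?thesis using True R' unfolding L R by (simp add: max_def)
  next
    case False
    show ?thesis
    proof (cases "x < 1")
      case True
      have "(\<integral>\<^sup>+z. indicator (cball 0 x) z \<partial>disc_measure) = ennreal (x\<^sup>2)"
      proof -
        have "(\<lambda>z. indicator (cball 0 x) z * indicator unit_disc z) = (indicator (cball (0::complex) x) :: _ \<Rightarrow> ennreal)"
          using True by (auto simp: indicator_def fun_eq_iff)
        then have "(\<integral>\<^sup>+z. indicator (cball 0 x) z \<partial>disc_measure) = ennreal (1/pi) * emeasure lborel (cball (0::complex) x)"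
          by (subst nn_integral_disc_measure) auto
        also have "\<dots> = ennreal (x\<^sup>2)"
          using False emeasure_cball[of x "0::complex"]
          by (simp add: unit_ball_vol_2 ennreal_mult'[symmetric])
        finally show ?thesis .
      qed
      moreover have c: "cball 0 x \<in> sets disc_measure"
        using True by (auto simp: disc_measure_def sets_restrict_space_iff)
      ultimately have cb: "emeasure disc_measure (cball 0 x) = ennreal (x\<^sup>2)" by simp
      have "{z \<in> unit_disc. x < cmod z} = space disc_measure - cball 0 x" by auto
      then have "emeasure disc_measure {z \<in> unit_disc. x < cmod z} = 1 - ennreal (x\<^sup>2)"
        using cb emeasure_compl[OF c] by simp
      also have "\<dots> = ennreal (1 - x\<^sup>2)"
        using ennreal_minus[of "x\<^sup>2" 1] unfolding ennreal_1 by (rule trans) simp_all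
      finally show ?thesis using False True R' unfolding L R by (simp add: max_def)
    next
      case n: False
      then have "{z \<in> unit_disc. x < cmod z} = {}" by auto
      then have "emeasure disc_measure {z \<in> unit_disc. x < cmod z} = 0" by (simp only: emeasure_empty)
      moreover have "(\<integral>\<^sup>+r. ennreal (2 * r) * indicator {max x 0..1} r \<partial>lborel) = 0"
      proof (cases "x = 1")
        case True then show ?thesis using R' by simp
      next
        case False
        with n have "{max x 0..1} = {}" by auto
        then show ?thesis by simp
      qed
      ultimately show ?thesis unfolding L R by (simp only:)
    qed
  qed
qed auto

lemma AE_radius_measure_iff:
  "(AE r in radius_measure. P r) \<longleftrightarrow> (AE r in lborel. 0 < r \<and> r < 1 \<longrightarrow> P r)"
proof -
  have "(AE r in radius_measure. P r) \<longleftrightarrow> (AE r in lborel. 0 < ennreal (2 * r) * indicator {0..1} r \<longrightarrow> P r)"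
    unfolding radius_measure_eq_density by (subst AE_density) auto
  also have "\<dots> \<longleftrightarrow> (AE r in lborel. 0 < r \<and> r < 1 \<longrightarrow> P r)"
  proof (rule eventually_subst)
    show "AE r in lborel. (0 < ennreal (2 * r) * indicator {0..1} r \<longrightarrow> P r) = (0 < r \<and> r < 1 \<longrightarrow> P r)"
      using AE_lborel_singleton[of 1]
      by eventually_elim (auto simp: indicator_def not_less)
  qed
  finally show ?thesis .
qed

text \<open>This ties the null sets named in the theorem to those of \<open>radius_measure\<close>.
  The density is positive on the open interval, and the endpoint \<open>0\<close>, where it
  vanishes, is a null set of its own.\<close>

lemma AE_lebesgue_on_iff_radius:
  "(AE r in lebesgue_on {0..<1}. P r) \<longleftrightarrow> (AE r in radius_measure. P r)"
proof -
  have "(AE r in lebesgue_on {0..<1}. P r) \<longleftrightarrow> (AE r in lborel. r \<in> {0..<1} \<longrightarrow> P r)"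
    by (subst AE_restrict_space_iff) (auto simp: AE_completion_iff)
  also have "\<dots> \<longleftrightarrow> (AE r in lborel. 0 < r \<and> r < 1 \<longrightarrow> P r)"
  proof (rule eventually_subst)
    show "AE r in lborel. (r \<in> {0..<1} \<longrightarrow> P r) = (0 < r \<and> r < 1 \<longrightarrow> P r)"
      using AE_lborel_singleton[of 0]
      by eventually_elim auto
  qed
  finally show ?thesis by (simp add: AE_radius_measure_iff)
qed

lemma AE_radius_bounds: "AE r in radius_measure. 0 < r \<and> r < 1"
  by (simp add: AE_radius_measure_iff)

lemma disc_integral_radial:
  fixes g :: "real \<Rightarrow> complex"
  assumes "g \<in> borel_measurable borel"
  shows "(LINT z|disc_measure. g (cmod z)) = (LINT r|radius_measure. g r)"
  unfolding radius_measure_def by (rule integral_distr[symmetric, OF measurable_cmod_disc assms])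

lemma AE_disc_radialI: "AE z in disc_measure. P (cmod z)" if "AE r in radius_measure. P r"
  using that unfolding radius_measure_def
  by (rule AE_distrD[OF measurable_cmod_disc])

section \<open>Harmonic functions\<close>

text \<open>The mean value theorem in direction \<open>a\<close> reduces the second difference to an
  increment of the derivative along \<open>a\<close>, which is linear up to a small error near
  \<open>z\<close>. Besides differentiability of \<open>u\<close> nearby, only differentiability of
  that partial derivative at \<open>z\<close> enters, as in Young's version of the symmetry
  theorem.\<close>

lemma second_difference_bound:
  fixes u :: "complex \<Rightarrow> complex" and a b z :: complex
  assumes S: "open S" "z \<in> S" and u: "\<And>w. w \<in> S \<Longrightarrow> u differentiable (at w)"
    and g: "(\<lambda>w. frechet_derivative u (at w) a) differentiable (at z)"
    and ab: "norm a = 1" "norm b = 1" and \<epsilon>: "0 < \<epsilon>"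
  shows "\<exists>\<delta>>0. \<forall>h. 0 < h \<and> h < \<delta> \<longrightarrow>
           norm (u (z + h *\<^sub>R a + h *\<^sub>R b) - u (z + h *\<^sub>R a) - u (z + h *\<^sub>R b) + u z
             - (h * h) *\<^sub>R frechet_derivative (\<lambda>w. frechet_derivative u (at w) a) (at z) b) \<le> \<epsilon> * (h * h)"
proof -
  define g where "g = (\<lambda>w. frechet_derivative u (at w) a)"
  define L where "L = frechet_derivative g (at z)"
  have gL: "(g has_derivative L) (at z)"
    using g unfolding g_def L_def by (simp add: frechet_derivative_works)
  interpret L: bounded_linear L using gL by (rule has_derivative_bounded_linear)
  obtain r where r: "0 < r" "ball z r \<subseteq> S" using S by (meson open_contains_ball)
  \<comment> \<open>A third of \<open>\<epsilon>\<close>, because the two errors below belong to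
    displacements of length at most \<open>2 * h\<close> and \<open>h\<close>.\<close>
  from gL \<epsilon> obtain d where d: "0 < d"
    and dL: "\<And>y. norm (y - z) < d \<Longrightarrow> norm (g y - g z - L (y - z)) \<le> \<epsilon> / 3 * norm (y - z)"
    unfolding has_derivative_at_alt by (metis divide_pos_pos zero_less_numeral)
  show ?thesis
  proof (intro exI[of _ "min (r / 2) (d / 2)"] conjI allI impI)
    show "0 < min (r / 2) (d / 2)" using r d by simp
    fix h assume "0 < h \<and> h < min (r / 2) (d / 2)"
    then have h: "0 < h" "2 * h < r" "2 * h < d" by auto
    \<comment> \<open>\<open>\<phi> h - \<phi> 0\<close> is the second difference minus its expected
      value \<open>(h * h) *\<^sub>R L b\<close>, so one application of the mean value theorem
      controls it.\<close>
    define \<phi> where "\<phi> = (\<lambda>t. u (z + t *\<^sub>R a + h *\<^sub>R b) - u (z + t *\<^sub>R a) - (t * h) *\<^sub>R L b)"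
    have n1: "norm (t *\<^sub>R a + h *\<^sub>R b) \<le> 2 * h" if "0 \<le> t" "t \<le> h" for t
      using norm_triangle_ineq[of "t *\<^sub>R a" "h *\<^sub>R b"] that ab h by simp
    have n2: "norm (t *\<^sub>R a) \<le> h" if "0 \<le> t" "t \<le> h" for t
      using that ab by simp
    have du: "((\<lambda>t. u (z + t *\<^sub>R a + c)) has_derivative (\<lambda>s. s *\<^sub>R g (z + t *\<^sub>R a + c))) (at t)"
      if "z + t *\<^sub>R a + c \<in> S" for t c
    proof -
      let ?D = "frechet_derivative u (at (z + t *\<^sub>R a + c))"
      have D: "(u has_derivative ?D) (at (z + t *\<^sub>R a + c))"
        using u[OF that] by (simp add: frechet_derivative_works)
      then have "((\<lambda>t. u (z + t *\<^sub>R a + c)) has_derivative (\<lambda>s. ?D (s *\<^sub>R a))) (at t)"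
        by (rule has_derivative_compose[rotated]) (auto intro!: derivative_eq_intros)
      then show ?thesis
        using linear_cmul[OF has_derivative_linear[OF D]] by (simp add: g_def)
    qed
    have d\<phi>: "(\<phi> has_derivative (\<lambda>s. s *\<^sub>R (g (z + t *\<^sub>R a + h *\<^sub>R b) - g (z + t *\<^sub>R a) - h *\<^sub>R L b))) (at t)"
      if t: "0 \<le> t" "t \<le> h" for t
    proof -
      have m: "z + t *\<^sub>R a + h *\<^sub>R b \<in> S" "z + t *\<^sub>R a + 0 \<in> S"
      proof -
        have "dist z (z + t *\<^sub>R a + h *\<^sub>R b) = norm (t *\<^sub>R a + h *\<^sub>R b)"
          unfolding dist_norm add.assoc by (simp only: norm_minus_commute[of z] add_diff_cancel_left')
        then have "z + t *\<^sub>R a + h *\<^sub>R b \<in> ball z r" using n1[OF t] h by simp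
        then show "z + t *\<^sub>R a + h *\<^sub>R b \<in> S" using r(2) by blast
        have "dist z (z + t *\<^sub>R a) = norm (t *\<^sub>R a)"
          unfolding dist_norm by (simp only: norm_minus_commute[of z] add_diff_cancel_left')
        then have "z + t *\<^sub>R a \<in> ball z r" using n2[OF t] h by simp
        then show "z + t *\<^sub>R a + 0 \<in> S" using r(2) by auto
      qed
      have lin: "((\<lambda>t. (t * h) *\<^sub>R L b) has_derivative (\<lambda>s. (s * h) *\<^sub>R L b)) (at t)"
        by (auto intro!: derivative_eq_intros)
      show ?thesis
        unfolding \<phi>_def
        using has_derivative_diff[OF has_derivative_diff[OF du[OF m(1)] du[OF m(2)]] lin]
        by (simp add: scaleR_diff_right)
    qed
    have "\<exists>x\<in>{0<..<h}. norm (\<phi> h - \<phi> 0) \<le>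
        norm ((h - 0) *\<^sub>R (g (z + x *\<^sub>R a + h *\<^sub>R b) - g (z + x *\<^sub>R a) - h *\<^sub>R L b))"
      using h d\<phi> by (intro mvt_general)
         (auto intro!: continuous_at_imp_continuous_on has_derivative_continuous)
    then obtain x where x: "0 < x" "x < h" and
      le: "norm (\<phi> h - \<phi> 0) \<le> h * norm (g (z + x *\<^sub>R a + h *\<^sub>R b) - g (z + x *\<^sub>R a) - h *\<^sub>R L b)"
      using h by auto
    have "norm (g (z + x *\<^sub>R a + h *\<^sub>R b) - g (z + x *\<^sub>R a) - h *\<^sub>R L b)
      = norm ((g (z + x *\<^sub>R a + h *\<^sub>R b) - g z - L (x *\<^sub>R a + h *\<^sub>R b)) - (g (z + x *\<^sub>R a) - g z - L (x *\<^sub>R a)))"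
      unfolding L.add L.scaleR by (simp add: algebra_simps)
    also have "\<dots> \<le> norm (g (z + x *\<^sub>R a + h *\<^sub>R b) - g z - L (x *\<^sub>R a + h *\<^sub>R b)) + norm (g (z + x *\<^sub>R a) - g z - L (x *\<^sub>R a))"
      by (rule norm_triangle_ineq4)
    also have "\<dots> \<le> \<epsilon> / 3 * norm (x *\<^sub>R a + h *\<^sub>R b) + \<epsilon> / 3 * norm (x *\<^sub>R a)"
      using dL[of "z + x *\<^sub>R a + h *\<^sub>R b"] dL[of "z + x *\<^sub>R a"] n1[of x] n2[of x] h x
      by (intro add_mono) (auto simp: add.assoc)
    also have "\<dots> \<le> \<epsilon> / 3 * (2 * h) + \<epsilon> / 3 * h"
      using n1[of x] n2[of x] x \<epsilon> by (intro add_mono mult_left_mono) auto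
    finally have "norm (g (z + x *\<^sub>R a + h *\<^sub>R b) - g (z + x *\<^sub>R a) - h *\<^sub>R L b) \<le> \<epsilon> * h" by simp
    with le h have "norm (\<phi> h - \<phi> 0) \<le> h * (\<epsilon> * h)"
      by (meson mult_left_mono order_trans less_imp_le)
    moreover have "\<phi> h - \<phi> 0 = u (z + h *\<^sub>R a + h *\<^sub>R b) - u (z + h *\<^sub>R a) - u (z + h *\<^sub>R b) + u z - (h * h) *\<^sub>R L b"
      by (simp add: \<phi>_def)
    ultimately show "norm (u (z + h *\<^sub>R a + h *\<^sub>R b) - u (z + h *\<^sub>R a) - u (z + h *\<^sub>R b) + u z
             - (h * h) *\<^sub>R frechet_derivative (\<lambda>w. frechet_derivative u (at w) a) (at z) b) \<le> \<epsilon> * (h * h)"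
      by (simp add: L_def g_def mult_ac)
  qed
qed

text \<open>The second difference is symmetric in the two directions, and after division by
  \<open>h * h\<close> it approximates both mixed derivatives. A third of their distance as
  tolerance gives a contradiction.\<close>

lemma mixed_partials_eq:
  assumes S: "open S" "z \<in> S" and u: "\<And>w. w \<in> S \<Longrightarrow> u differentiable (at w)"
    and dd: "dx u differentiable (at z)" "dy u differentiable (at z)"
  shows "dy (dx u) z = dx (dy u) z"
proof (rule ccontr)
  assume ne: "dy (dx u) z \<noteq> dx (dy u) z"
  define \<epsilon> where "\<epsilon> = norm (dy (dx u) z - dx (dy u) z) / 3"
  have \<epsilon>: "\<epsilon> > 0" using ne by (simp add: \<epsilon>_def)
  let ?\<Delta> = "\<lambda>h. u (z + h *\<^sub>R 1 + h *\<^sub>R \<i>) - u (z + h *\<^sub>R 1) - u (z + h *\<^sub>R \<i>) + u z"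
  have X: "dx u = (\<lambda>w. frechet_derivative u (at w) 1)" "dy u = (\<lambda>w. frechet_derivative u (at w) \<i>)"
    by (auto simp: dx_def dy_def)
  obtain d1 where d1: "d1 > 0" "\<And>h. 0 < h \<Longrightarrow> h < d1 \<Longrightarrow> norm (?\<Delta> h - (h * h) *\<^sub>R dy (dx u) z) \<le> \<epsilon> * (h * h)"
    using second_difference_bound[OF S u, where a = 1 and b = \<i> and \<epsilon> = \<epsilon>] dd \<epsilon> unfolding X by (auto simp: dy_def)
  obtain d2 where d2: "d2 > 0" "\<And>h. 0 < h \<Longrightarrow> h < d2 \<Longrightarrow> norm (?\<Delta> h - (h * h) *\<^sub>R dx (dy u) z) \<le> \<epsilon> * (h * h)"
    using second_difference_bound[OF S u, where a = \<i> and b = 1 and \<epsilon> = \<epsilon>] dd \<epsilon> unfolding X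
    by (auto simp: dx_def algebra_simps)
  define h where "h = min d1 d2 / 2"
  have h: "0 < h" "h < d1" "h < d2" using d1 d2 by (auto simp: h_def)
  have "(h * h) * norm (dy (dx u) z - dx (dy u) z) = norm ((h * h) *\<^sub>R (dy (dx u) z - dx (dy u) z))"
    by simp
  also have "\<dots> = norm ((?\<Delta> h - (h * h) *\<^sub>R dx (dy u) z) - (?\<Delta> h - (h * h) *\<^sub>R dy (dx u) z))"
    by (simp add: scaleR_diff_right)
  also have "\<dots> \<le> \<epsilon> * (h * h) + \<epsilon> * (h * h)"
    by (rule order_trans[OF norm_triangle_ineq4 add_mono[OF d2(2)[OF h(1,3)] d1(2)[OF h(1,2)]]])
  finally have "(h * h) * norm (dy (dx u) z - dx (dy u) z) \<le> (h * h) * (2 * \<epsilon>)" by (simp add: mult_ac)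
  then have "norm (dy (dx u) z - dx (dy u) z) \<le> 2 * \<epsilon>" using h by simp
  with ne show False by (simp add: \<epsilon>_def)
qed

section \<open>Splitting harmonic functions into holomorphic and antiholomorphic parts\<close>

lemma has_field_derivative_if_Cauchy_Riemann:
  assumes "(f has_derivative L) (at z)" and "L \<i> = \<i> * L 1"
  shows "(f has_field_derivative L 1) (at z)"
proof -
  interpret L: bounded_linear L using assms(1) by (rule has_derivative_bounded_linear)
  have "L h = L 1 * h" for h
  proof -
    have "L h = L (Re h *\<^sub>R 1 + Im h *\<^sub>R \<i>)"
      by (rule arg_cong[where f = L]) (simp add: complex_eq_iff)
    also have "\<dots> = of_real (Re h) * L 1 + of_real (Im h) * (\<i> * L 1)"
      unfolding L.add L.scaleR assms(2) by (simp add: scaleR_conv_of_real)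
    also have "\<dots> = L 1 * h"
      by (simp add: complex_eq_iff algebra_simps)
    finally show ?thesis .
  qed
  then have "L = (*) (L 1)" by (rule ext)
  with assms(1) show ?thesis by (simp add: has_field_derivative_def)
qed

text \<open>The Wirtinger derivative of a harmonic \<open>u\<close> with respect to
  \<open>z\<close>, called \<open>f\<close> below, is holomorphic: vanishing of the Laplacian and
  symmetry of the mixed derivatives are its Cauchy-Riemann equations. Convexity provides a primitive
  \<open>F\<close>, and \<open>u - F\<close> is then antiholomorphic.\<close>

lemma harmonic_on_imp_holomorphic_decomposition:
  assumes "open S" "convex S" and u: "harmonic_on u S"
  obtains F G where "F holomorphic_on S" "G holomorphic_on S"
    and "\<And>z. z \<in> S \<Longrightarrow> u z = F z + cnj (G z)"
proof -
  have d: "u differentiable (at z)" "dx u differentiable (at z)" "dy u differentiable (at z)"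
    and lap: "dx (dx u) z + dy (dy u) z = 0" if "z \<in> S" for z
    using u that unfolding harmonic_on_def by blast+
  define f where "f = (\<lambda>z. (dx u z - \<i> * dy u z) / 2)"
  have f: "\<exists>f'. (f has_field_derivative f') (at z)" if z: "z \<in> S" for z
  proof -
    have x: "(dx u has_derivative frechet_derivative (dx u) (at z)) (at z)"
      and y: "(dy u has_derivative frechet_derivative (dy u) (at z)) (at z)"
      using d[OF z] by (simp_all add: frechet_derivative_works)
    have D: "(f has_derivative (\<lambda>h. (frechet_derivative (dx u) (at z) h - \<i> * frechet_derivative (dy u) (at z) h) / 2)) (at z)"
      unfolding f_def by (auto intro!: derivative_eq_intros x y)
    show ?thesis
    proof (rule exI, rule has_field_derivative_if_Cauchy_Riemann[OF D])
      have "dy (dx u) z = dx (dy u) z"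
        using mixed_partials_eq[OF assms(1) z] d z by auto
      moreover have "dy (dy u) z = - dx (dx u) z"
        using lap[OF z] by (metis add_eq_0_iff)
      ultimately show "(frechet_derivative (dx u) (at z) \<i> - \<i> * frechet_derivative (dy u) (at z) \<i>) / 2 =
          \<i> * ((frechet_derivative (dx u) (at z) 1 - \<i> * frechet_derivative (dy u) (at z) 1) / 2)"
        by (simp add: dx_def[of "dx u"] dy_def[of "dx u"] dx_def[of "dy u"] dy_def[of "dy u"] field_simps)
    qed
  qed
  then have "f holomorphic_on S"
    using assms(1) by (auto simp: holomorphic_on_open)
  then obtain F where F: "\<And>z. z \<in> S \<Longrightarrow> (F has_field_derivative f z) (at z)"
    using holomorphic_convex_primitive'[OF assms(2,1)] assms(1) by (metis at_within_open)
  define G where "G = (\<lambda>z. cnj (u z - F z))"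
  have "\<exists>f'. (G has_field_derivative f') (at z)" if z: "z \<in> S" for z
  proof -
    have U: "(u has_derivative frechet_derivative u (at z)) (at z)"
      using d(1)[OF z] by (simp add: frechet_derivative_works)
    have D: "(G has_derivative (\<lambda>h. cnj (frechet_derivative u (at z) h - f z * h))) (at z)"
      unfolding G_def
      by (intro has_derivative_cnj has_derivative_diff U F[OF z, unfolded has_field_derivative_def])
    show ?thesis
      by (rule exI, rule has_field_derivative_if_Cauchy_Riemann[OF D])
         (simp add: f_def dx_def dy_def complex_eq_iff field_simps)
  qed
  then have "G holomorphic_on S" using assms(1) by (auto simp: holomorphic_on_open)
  moreover have "F holomorphic_on S" using assms(1) F by (auto simp: holomorphic_on_open)
  ultimately show ?thesis by (intro that[of F G]) (auto simp: G_def)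
qed

lemma
  assumes S: "open S" and FG: "F holomorphic_on S" "G holomorphic_on S"
    and u: "\<And>z. z \<in> S \<Longrightarrow> u z = F z + cnj (G z)" and z: "z \<in> S"
  shows differentiable_holomorphic_sum: "u differentiable (at z)"
    and dx_holomorphic_sum: "dx u z = deriv F z + cnj (deriv G z)"
    and dy_holomorphic_sum: "dy u z = \<i> * deriv F z + cnj (\<i> * deriv G z)"
proof -
  have "((\<lambda>z. F z + cnj (G z)) has_derivative (\<lambda>h. deriv F z * h + cnj (deriv G z * h))) (at z)"
    using FG S z
    by (intro has_derivative_add has_derivative_cnj)
       (auto simp flip: has_field_derivative_def intro: holomorphic_derivI)
  then have D: "(u has_derivative (\<lambda>h. deriv F z * h + cnj (deriv G z * h))) (at z)"
    by (rule has_derivative_transform_within_open[OF _ S z]) (simp add: u)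
  show "u differentiable (at z)" using D by (auto simp: differentiable_def)
  have "frechet_derivative u (at z) = (\<lambda>h. deriv F z * h + cnj (deriv G z * h))"
    using frechet_derivative_at[OF D] by simp
  then show "dx u z = deriv F z + cnj (deriv G z)" "dy u z = \<i> * deriv F z + cnj (\<i> * deriv G z)"
    by (simp_all add: dx_def dy_def)
qed

text \<open>A derivative along either axis of such a sum is again such a sum, built from
  \<open>deriv F\<close> and \<open>deriv G\<close> up to factors \<open>\<i>\<close>; the formulas
  for first derivatives are thus applied twice. Equality is asked only on \<open>S\<close>, so
  functions extended by \<open>0\<close> qualify.\<close>

lemma harmonic_on_holomorphic_sum:
  assumes S: "open S" and FG: "F holomorphic_on S" "G holomorphic_on S"
    and u: "\<And>z. z \<in> S \<Longrightarrow> u z = F z + cnj (G z)"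
  shows "harmonic_on u S"
proof -
  have cont: "continuous_on S v"
    if "F holomorphic_on S" "G holomorphic_on S" "\<And>z. z \<in> S \<Longrightarrow> v z = F z + cnj (G z)" for F G v
  proof -
    have "continuous_on S (\<lambda>z. F z + cnj (G z))"
      using that by (intro continuous_intros holomorphic_on_imp_continuous_on)
    then show ?thesis using that(3) by (simp cong: continuous_on_cong)
  qed
  have h1: "deriv F holomorphic_on S" "deriv G holomorphic_on S"
    "(\<lambda>z. \<i> * deriv F z) holomorphic_on S" "(\<lambda>z. \<i> * deriv G z) holomorphic_on S"
    using FG S by (auto intro!: holomorphic_intros)
  have x: "dx u z = deriv F z + cnj (deriv G z)"
    and y: "dy u z = \<i> * deriv F z + cnj (\<i> * deriv G z)" if "z \<in> S" for z
    using dx_holomorphic_sum[OF S FG u that] dy_holomorphic_sum[OF S FG u that] by auto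
  have xx: "dx (dx u) z = deriv (deriv F) z + cnj (deriv (deriv G) z)"
    and xy: "dy (dx u) z = \<i> * deriv (deriv F) z + cnj (\<i> * deriv (deriv G) z)"
    and yx: "dx (dy u) z = deriv (\<lambda>z. \<i> * deriv F z) z + cnj (deriv (\<lambda>z. \<i> * deriv G z) z)"
    and yy: "dy (dy u) z = \<i> * deriv (\<lambda>z. \<i> * deriv F z) z + cnj (\<i> * deriv (\<lambda>z. \<i> * deriv G z) z)"
    if "z \<in> S" for z
    using dx_holomorphic_sum[OF S h1(1,2), of "dx u" z] dy_holomorphic_sum[OF S h1(1,2), of "dx u" z]
      dx_holomorphic_sum[OF S h1(3,4), of "dy u" z] dy_holomorphic_sum[OF S h1(3,4), of "dy u" z] x y that
    by auto
  have h2: "(deriv f) holomorphic_on S" "(\<lambda>z. \<i> * deriv f z) holomorphic_on S"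
    if "f \<in> {deriv F, deriv G, \<lambda>z. \<i> * deriv F z, \<lambda>z. \<i> * deriv G z}" for f
    using h1 S that by (auto intro!: holomorphic_intros holomorphic_deriv)
  have di: "deriv (\<lambda>z. \<i> * f z) z = \<i> * deriv f z" if "f holomorphic_on S" "z \<in> S" for f z
    using that S holomorphic_on_imp_differentiable_at by (intro deriv_cmult) blast
  show ?thesis
    unfolding harmonic_on_def
  proof (intro conjI ballI)
    fix z assume z: "z \<in> S"
    show "u differentiable (at z)" by (rule differentiable_holomorphic_sum[OF S FG u z])
    show "dx u differentiable (at z)" by (rule differentiable_holomorphic_sum[OF S h1(1,2) _ z, OF x])
    show "dy u differentiable (at z)" by (rule differentiable_holomorphic_sum[OF S h1(3,4) _ z, OF y])
    show "dx (dx u) z + dy (dy u) z = 0"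
      using xx[OF z] yy[OF z] by (simp add: di h1 z)
  next
    show "continuous_on S (dx (dx u))" by (rule cont[OF h2(1) h2(1) xx]) auto
    show "continuous_on S (dy (dx u))" by (rule cont[OF h2(2) h2(2) xy]) auto
    show "continuous_on S (dx (dy u))" by (rule cont[OF h2(1) h2(1) yx]) auto
    show "continuous_on S (dy (dy u))" by (rule cont[OF h2(2) h2(2) yy]) auto
  qed
qed

section \<open>The reproducing kernel\<close>

lemma cis_multiple_Arg: "z \<noteq> 0 \<Longrightarrow> cis (of_int k * Arg z) = sgn z powi k"
  by (simp flip: cis_power_int add: cis_Arg)

text \<open>\<open>Arg\<close> jumps along the negative real axis, but the angular factor is an
  integer power of \<open>sgn z\<close>, which is Borel. At the origin the convention
  \<open>Arg 0 = 0\<close> makes the factor \<open>1\<close>.\<close>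

lemma borel_measurable_quasihom [measurable]:
  assumes [measurable]: "\<phi> \<in> borel_measurable borel"
  shows "quasihom k \<phi> \<in> borel_measurable borel"
proof -
  have "quasihom k \<phi> = (\<lambda>z. (if z = 0 then 1 else
      if k \<ge> 0 then sgn z ^ nat k else inverse (sgn z) ^ nat (- k)) * \<phi> (cmod z))"
    by (auto simp: quasihom_def cis_multiple_Arg power_int_def fun_eq_iff Arg_zero)
  also have "\<dots> \<in> borel_measurable borel"
    by measurable
  finally show ?thesis .
qed

lemma quasihom_mult_powers:
  "quasihom k \<phi> w * w ^ m * cnj w ^ n
     = quasihom (k + int m - int n) (\<lambda>r. \<phi> r * of_real r ^ (m + n)) w"
proof -
  have w: "w = of_real (cmod w) * cis (Arg w)"
    using rcis_cmod_Arg[of w] by (simp add: rcis_def)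
  have m: "w ^ m = of_real (cmod w) ^ m * cis (of_int (int m) * Arg w)"
  proof -
    have "w ^ m = (of_real (cmod w) * cis (Arg w)) ^ m" using w by (rule arg_cong)
    then show ?thesis by (simp only: power_mult_distrib Complex.DeMoivre of_int_of_nat_eq)
  qed
  have "cnj w = of_real (cmod w) * cis (- Arg w)"
    using arg_cong[OF w, of cnj] by (simp add: cis_cnj)
  then have "cnj w ^ n = (of_real (cmod w) * cis (- Arg w)) ^ n" by (rule arg_cong)
  then have n: "cnj w ^ n = of_real (cmod w) ^ n * cis (- (of_int (int n) * Arg w))"
    by (simp only: power_mult_distrib Complex.DeMoivre of_int_of_nat_eq mult_minus_right)
  have "cis (of_int (k + int m - int n) * Arg w)
      = cis (of_int k * Arg w) * cis (of_int (int m) * Arg w) * cis (- (of_int (int n) * Arg w))"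
    by (simp add: cis_mult algebra_simps)
  then show ?thesis
    unfolding quasihom_def m n by (simp add: power_add)
qed

text \<open>In degree \<open>0\<close> the integrand depends on the modulus alone; in any other
  degree rotation kills the integral. The orthogonality relations below come from this
  dichotomy.\<close>

lemma disc_integral_quasihom:
  assumes [measurable]: "\<phi> \<in> borel_measurable borel"
  shows "(LINT z|disc_measure. quasihom k \<phi> z) = (if k = 0 then LINT r|radius_measure. \<phi> r else 0)"
proof (cases "k = 0")
  case True
  then show ?thesis by (simp add: quasihom_def disc_integral_radial)
next
  case False
  have "(LINT z|disc_measure. quasihom k \<phi> z) = 0"
  proof (rule disc_integral_eq_0[OF _ False])
    fix \<alpha> and z :: complex assume z: "z \<noteq> 0"
    have "sgn (cis \<alpha> * z) = cis \<alpha> * sgn z" by (simp add: sgn_mult)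
    with z show "quasihom k \<phi> (cis \<alpha> * z) = cis (of_int k * \<alpha>) * quasihom k \<phi> z"
      by (simp add: quasihom_def cis_multiple_Arg norm_mult power_int_mult_distrib cis_power_int)
  qed simp
  with False show ?thesis by simp
qed

lemma disc_integral_quasihom_powers:
  assumes [measurable]: "\<phi> \<in> borel_measurable borel"
  shows "(LINT w|disc_measure. quasihom k \<phi> w * w ^ m * cnj w ^ n)
    = (if k + int m = int n then LINT r|radius_measure. \<phi> r * of_real r ^ (m + n) else 0)"
  by (simp add: quasihom_mult_powers disc_integral_quasihom)

lemma radius_power_integral:
  "(LINT r|radius_measure. complex_of_real r ^ n) = 2 / (of_nat n + 2)"
proof -
  have "((\<lambda>r. 2 * r ^ (n + 2) / (n + 2)) has_real_derivative 2 * r ^ Suc n) (at r)" for r :: real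
    by (rule DERIV_cong[OF DERIV_cdivide[OF DERIV_cmult[OF DERIV_pow]]]) (simp add: field_simps)
  then have "has_bochner_integral lborel (\<lambda>r. 2 * r ^ Suc n * indicator {0..1} r)
      (2 * 1 ^ (n + 2) / (n + 2) - 2 * 0 ^ (n + 2) / (n + 2) :: real)"
    by (intro has_bochner_integral_FTC_Icc_real) (auto simp del: power_Suc)
  then have I: "(LINT r|lborel. 2 * r ^ Suc n * indicator {0..1} r) = 2 / (real n + 2)"
    by (simp add: has_bochner_integral_iff)
  have "radius_measure = density lborel (\<lambda>r. ennreal (2 * r * indicator {0..1} r))"
    unfolding radius_measure_eq_density by (rule arg_cong[where f = "density lborel"]) (auto simp: indicator_def)
  then have "(LINT r|radius_measure. r ^ n) = (LINT r|lborel. (2 * r * indicator {0..1} r) *\<^sub>R r ^ n)"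
    by (subst \<open>radius_measure = _\<close>, intro integral_density) (auto simp: indicator_def)
  also have "\<dots> = 2 / (real n + 2)"
    using I by (simp add: mult_ac)
  finally have "of_real (LINT r|radius_measure. r ^ n) = (2 / (of_nat n + 2) :: complex)" by simp
  then show ?thesis by (simp flip: integral_complex_of_real)
qed

section \<open>Power series under the integral, and moments of harmonic functions\<close>

lemma borel_measurable_disc_continuous:
  assumes "continuous_on unit_disc u"
  shows "u \<in> borel_measurable disc_measure"
  using continuous_imp_measurable_on_sets_lebesgue[OF assms]
  by (simp add: disc_measure_def measurable_density_eq1)

text \<open>Absolute summability of the coefficients and the bound \<open>1\<close> on the functions
  \<open>q n\<close> give domination by \<open>norm (h w) * norm (c n)\<close>. Both the kernel and
  truncated Taylor series fit this pattern.\<close>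

lemma disc_integral_power_series:
  fixes h :: "complex \<Rightarrow> complex" and c :: "nat \<Rightarrow> complex" and q :: "nat \<Rightarrow> complex \<Rightarrow> complex"
  assumes h: "integrable disc_measure h" and c: "summable (\<lambda>n. norm (c n))"
    and q: "\<And>n. q n \<in> borel_measurable borel" "\<And>n w. w \<in> unit_disc \<Longrightarrow> norm (q n w) \<le> 1"
  shows "(\<lambda>n. c n * (LINT w|disc_measure. h w * q n w)) sums (LINT w|disc_measure. h w * (\<Sum>n. c n * q n w))"
proof -
  have hm [measurable]: "h \<in> borel_measurable disc_measure" using h by simp
  have qm [measurable]: "q n \<in> borel_measurable disc_measure" for n
    using q(1) by (rule borel_measurable_disc_measure)
  have le: "norm (h w * q n w) \<le> norm (h w)" if "w \<in> unit_disc" for n w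
    using q(2)[OF that] by (simp add: norm_mult mult_left_le)
  have hq: "integrable disc_measure (\<lambda>w. h w * q n w)" for n
    by (rule Bochner_Integration.integrable_bound[OF h]) (auto intro!: AE_I2 le)
  have bd: "norm (c n * q n w) \<le> norm (c n)" if "w \<in> unit_disc" for n w
    using q(2)[OF that] by (simp add: norm_mult mult_left_le)
  have sm: "summable (\<lambda>n. norm (c n * q n w))" if "w \<in> unit_disc" for w
    by (rule summable_comparison_test'[OF c]) (use bd[OF that] in simp)
  have "(\<lambda>n. LINT w|disc_measure. h w * (c n * q n w)) sums (LINT w|disc_measure. (\<Sum>n. h w * (c n * q n w)))"
  proof (rule sums_integral)
    show "integrable disc_measure (\<lambda>w. h w * (c n * q n w))" for n
      using integrable_mult_right[OF hq, of "c n" n] by (simp add: mult_ac)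
    show "AE w in disc_measure. summable (\<lambda>n. norm (h w * (c n * q n w)))"
      using sm by (intro AE_I2) (simp add: norm_mult summable_mult)
    show "summable (\<lambda>n. LINT w|disc_measure. norm (h w * (c n * q n w)))"
    proof (rule summable_comparison_test'[OF summable_mult[OF c, of "LINT w|disc_measure. norm (h w)"]])
      fix n
      have "(LINT w|disc_measure. norm (h w * (c n * q n w))) \<le> (LINT w|disc_measure. norm (h w) * norm (c n))"
      proof (rule integral_mono)
        show "integrable disc_measure (\<lambda>w. norm (h w * (c n * q n w)))"
          using integrable_mult_right[OF hq, of "c n" n] by (simp add: mult_ac)
        show "integrable disc_measure (\<lambda>w. norm (h w) * norm (c n))"
          using h by simp
        show "norm (h w * (c n * q n w)) \<le> norm (h w) * norm (c n)" if "w \<in> space disc_measure" for w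
          using bd[of w n] that by (simp add: norm_mult mult_left_mono)
      qed
      then show "norm (LINT w|disc_measure. norm (h w * (c n * q n w))) \<le> (LINT w|disc_measure. norm (h w)) * norm (c n)"
        using h by simp
    qed
  qed
  moreover have "(LINT w|disc_measure. (\<Sum>n. h w * (c n * q n w))) = (LINT w|disc_measure. h w * (\<Sum>n. c n * q n w))"
    by (rule Bochner_Integration.integral_cong) (auto intro!: suminf_mult summable_norm_cancel[OF sm])
  moreover have "(LINT w|disc_measure. h w * (c n * q n w)) = c n * (LINT w|disc_measure. h w * q n w)" for n
    by (subst integral_mult_right_zero[symmetric]) (simp add: mult_ac)
  ultimately show ?thesis by simp
qed

lemma borel_measurable_cnj [measurable]: "cnj \<in> borel_measurable borel"
  by (intro borel_measurable_continuous_onI continuous_intros)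

text \<open>A Taylor series on the open disc need not converge absolutely up to the boundary, so
  \<open>h\<close> is required to vanish from radius \<rho> on. Inside that radius, rescaling by
  \<rho> yields absolutely summable coefficients. The map \<open>e\<close> stands for the identity
  or conjugation.\<close>

lemma disc_integral_truncated_power_series:
  fixes h f e :: "complex \<Rightarrow> complex" and a :: "nat \<Rightarrow> complex"
  assumes h: "integrable disc_measure h" "\<And>w. \<rho> \<le> norm w \<Longrightarrow> h w = 0"
    and e: "e \<in> borel_measurable borel" "\<And>w. norm (e w) = norm w"
    and f: "\<And>w. w \<in> unit_disc \<Longrightarrow> (\<lambda>m. a m * e w ^ m) sums f w"
    and \<rho>: "0 < \<rho>" "\<rho> < 1"
  shows "(\<lambda>m. a m * (LINT w|disc_measure. h w * e w ^ m)) sums (LINT w|disc_measure. h w * f w)"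
proof -
  define q where "q = (\<lambda>m w. if norm w < \<rho> then (e w / of_real \<rho>) ^ m else 0)"
  have aq: "a m * of_real \<rho> ^ m * q m w = a m * e w ^ m" if "norm w < \<rho>" for m w
    using that \<rho> by (simp add: q_def power_divide)
  have hq: "h w * q m w = h w * e w ^ m / of_real \<rho> ^ m" for m w
    using h(2)[of w] by (cases "norm w < \<rho>") (auto simp: q_def power_divide)
  have s: "summable (\<lambda>m. norm (a m * of_real \<rho> ^ m))"
  proof (rule powser_insidea)
    \<comment> \<open>A point halfway between radius \<rho> and the unit circle: convergence at a
      larger radius gives absolute convergence at radius \<rho>.\<close>
    define \<sigma> :: complex where "\<sigma> = of_real ((1 + \<rho>) / 2)"
    have n: "norm \<sigma> = (1 + \<rho>) / 2" using \<rho> unfolding \<sigma>_def norm_of_real by simp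
    then show "norm (of_real \<rho>::complex) < norm (e \<sigma>)" using \<rho> by (simp add: e)
    have "\<sigma> \<in> unit_disc" using n \<rho> by simp
    from sums_summable[OF f[OF this]] show "summable (\<lambda>m. a m * e \<sigma> ^ m)" .
  qed
  have "(\<lambda>m. (a m * of_real \<rho> ^ m) * (LINT w|disc_measure. h w * q m w))
      sums (LINT w|disc_measure. h w * (\<Sum>m. (a m * of_real \<rho> ^ m) * q m w))"
  proof (rule disc_integral_power_series[OF h(1) s])
    have [measurable]: "e \<in> borel_measurable borel" by (rule e)
    show "q m \<in> borel_measurable borel" for m unfolding q_def by measurable
    show "norm (q m w) \<le> 1" for m w
      using \<rho> by (auto simp: q_def norm_power norm_divide e power_le_one)
  qed
  moreover have "(a m * of_real \<rho> ^ m) * (LINT w|disc_measure. h w * q m w) = a m * (LINT w|disc_measure. h w * e w ^ m)" for m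
    using \<rho> by (simp add: hq)
  moreover have "(LINT w|disc_measure. h w * (\<Sum>m. (a m * of_real \<rho> ^ m) * q m w)) = (LINT w|disc_measure. h w * f w)"
  proof (rule Bochner_Integration.integral_cong[OF refl])
    fix w assume w: "w \<in> space disc_measure"
    show "h w * (\<Sum>m. (a m * of_real \<rho> ^ m) * q m w) = h w * f w"
    proof (cases "norm w < \<rho>")
      case True
      then have "(\<Sum>m. (a m * of_real \<rho> ^ m) * q m w) = (\<Sum>m. a m * e w ^ m)" by (simp add: aq)
      also have "\<dots> = f w" using sums_unique[OF f[of w]] w by simp
      finally show ?thesis by simp
    next
      case False then show ?thesis using h(2)[of w] by simp
    qed
  qed
  ultimately show ?thesis by simp
qed

lemma disc_integral_truncation_tendsto:
  fixes v :: "complex \<Rightarrow> complex"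
  assumes v: "integrable disc_measure v"
  shows "(\<lambda>k. LINT w|disc_measure. (cnj w ^ n * of_bool (norm w < 1 - inverse (real (Suc k)))) * v w)
     \<longlonglongrightarrow> (LINT w|disc_measure. cnj w ^ n * v w)"
proof (rule integral_dominated_convergence[where w = "\<lambda>w. norm (v w)"])
  have [measurable]: "v \<in> borel_measurable disc_measure" using v by simp
  have [measurable]: "(\<lambda>w. cnj w ^ n) \<in> borel_measurable disc_measure"
    by (intro borel_measurable_disc_measure borel_measurable_continuous_onI continuous_intros)
  show "(\<lambda>w. cnj w ^ n * v w) \<in> borel_measurable disc_measure" by measurable
  show "(\<lambda>w. (cnj w ^ n * of_bool (norm w < 1 - inverse (real (Suc k)))) * v w) \<in> borel_measurable disc_measure" for k
    by (simp add: of_bool_def)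
  show "integrable disc_measure (\<lambda>w. norm (v w))" using v by simp
  show "AE w in disc_measure. norm ((cnj w ^ n * of_bool (norm w < 1 - inverse (real (Suc k)))) * v w) \<le> norm (v w)" for k
    by (intro AE_I2) (auto simp: norm_mult norm_power power_le_one mult_left_le_one_le)
  show "AE w in disc_measure. (\<lambda>k. (cnj w ^ n * of_bool (norm w < 1 - inverse (real (Suc k)))) * v w) \<longlonglongrightarrow> cnj w ^ n * v w"
  proof (rule AE_I2)
    fix w assume "w \<in> space disc_measure"
    then have "norm w < 1" by simp
    moreover have "(\<lambda>k. 1 - inverse (real (Suc k))) \<longlonglongrightarrow> 1"
      using tendsto_diff[OF tendsto_const[of 1] LIMSEQ_inverse_real_of_nat] by simp
    ultimately have "eventually (\<lambda>k. norm w < 1 - inverse (real (Suc k))) sequentially"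
      by (simp add: order_tendsto_iff)
    then have "eventually (\<lambda>k. cnj w ^ n * v w = (cnj w ^ n * of_bool (norm w < 1 - inverse (real (Suc k)))) * v w) sequentially"
      by eventually_elim simp
    then show "(\<lambda>k. (cnj w ^ n * of_bool (norm w < 1 - inverse (real (Suc k)))) * v w) \<longlonglongrightarrow> cnj w ^ n * v w"
      by (rule Lim_transform_eventually[OF tendsto_const])
  qed
qed

lemma integrable_disc_bounded:
  fixes f :: "complex \<Rightarrow> complex"
  assumes "f \<in> borel_measurable disc_measure" and "\<And>w. w \<in> unit_disc \<Longrightarrow> norm (f w) \<le> B"
  shows "integrable disc_measure f"
  using assms by (intro disc.integrable_const_bound[where B = B]) auto

text \<open>Only \<open>u\<close> is assumed integrable, not \<open>F\<close> and \<open>G\<close>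
  separately, so the two series are integrated over discs of radius \<open>\<rho> k\<close>.
  Orthogonality leaves a single power, with the same factor \<open>C\<close> for every radius, and
  dominated convergence takes the limit.\<close>

lemma harmonic_moment:
  assumes u: "integrable disc_measure u"
    and F: "\<And>w. w \<in> unit_disc \<Longrightarrow> (\<lambda>m. a m * w ^ m) sums F w"
    and G: "\<And>w. w \<in> unit_disc \<Longrightarrow> (\<lambda>m. b m * cnj w ^ m) sums G w"
    and FG: "\<And>w. w \<in> unit_disc \<Longrightarrow> u w = F w + G w"
    and cont: "continuous_on unit_disc F" "continuous_on unit_disc G"
  shows "(LINT w|disc_measure. u w * cnj w ^ n) = (a n + (if n = 0 then b n else 0)) / of_nat (Suc n)"
proof -
  \<comment> \<open>For \<open>n = 0\<close> the constant terms of both series contribute.\<close>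
  define C where "C = a n + (if n = 0 then b n else 0)"
  define \<rho> where "\<rho> = (\<lambda>k. 1 - inverse (real (Suc k)))"
  define h where "h = (\<lambda>k w. cnj w ^ n * of_bool (norm w < \<rho> k))"
  \<comment> \<open>Index \<open>0\<close> is excluded because \<open>\<rho> 0 = 0\<close>.\<close>
  have trunc: "(LINT w|disc_measure. h k w * u w) = C * (LINT w|disc_measure. h k w * w ^ n)" if k: "k > 0" for k
  proof -
    have \<rho>: "0 < \<rho> k" "\<rho> k < 1" using k by (auto simp: \<rho>_def field_simps)
    have hb: "h k \<in> borel_measurable borel"
      unfolding h_def of_bool_def by measurable
    have hq: "h k w = quasihom 0 (\<lambda>r. of_bool (r < \<rho> k)) w * w ^ 0 * cnj w ^ n" for w
      by (simp add: h_def quasihom_def)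
    have hi: "integrable disc_measure (\<lambda>w. h k w * v w)"
      if v: "continuous_on unit_disc v" for v
    proof -
      have "bounded (v ` cball 0 (\<rho> k))"
        using \<rho> by (intro compact_imp_bounded compact_continuous_image continuous_on_subset[OF v]) auto
      then obtain B where B: "\<And>w. w \<in> cball 0 (\<rho> k) \<Longrightarrow> norm (v w) \<le> B"
        unfolding bounded_iff by blast
      have B0: "0 \<le> B" using B[of 0] \<rho> by (auto intro: order_trans[OF norm_ge_zero])
      have [measurable]: "h k \<in> borel_measurable disc_measure" "v \<in> borel_measurable disc_measure"
        using hb borel_measurable_disc_measure borel_measurable_disc_continuous[OF v] by auto
      show ?thesis
      proof (rule integrable_disc_bounded[where B = B])
        fix w :: complex assume "w \<in> unit_disc"
        then have "norm (h k w) \<le> 1" by (simp add: h_def norm_mult norm_power power_le_one)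
        then show "norm (h k w * v w) \<le> B"
          using B[of w] B0 by (cases "norm w < \<rho> k") (auto simp: norm_mult h_def mult_left_le_one_le intro: order_trans[rotated])
      qed measurable
    qed
    have h1: "integrable disc_measure (h k)" using hi[of "\<lambda>_. 1"] by simp
    have h0: "h k w = 0" if "\<rho> k \<le> norm w" for w using that by (simp add: h_def)
    have bb [measurable]: "(\<lambda>r. of_bool (r < \<rho> k) :: complex) \<in> borel_measurable borel"
      unfolding of_bool_def by measurable
    have z1: "(LINT w|disc_measure. h k w * w ^ m) = 0" if "m \<noteq> n" for m
    proof -
      have "(LINT w|disc_measure. h k w * w ^ m) = (LINT w|disc_measure. quasihom 0 (\<lambda>r. of_bool (r < \<rho> k)) w * w ^ m * cnj w ^ n)"
        by (simp add: hq mult_ac)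
      also have "\<dots> = 0" using that by (subst disc_integral_quasihom_powers) auto
      finally show ?thesis .
    qed
    have z2: "(LINT w|disc_measure. h k w * cnj w ^ m) = 0" if "m + n \<noteq> 0" for m
    proof -
      have "(LINT w|disc_measure. h k w * cnj w ^ m) = (LINT w|disc_measure. quasihom 0 (\<lambda>r. of_bool (r < \<rho> k)) w * w ^ 0 * cnj w ^ (n + m))"
        by (simp add: hq mult_ac power_add)
      also have "\<dots> = 0" using that by (subst disc_integral_quasihom_powers) auto
      finally show ?thesis .
    qed
    have "(\<lambda>m. a m * (LINT w|disc_measure. h k w * w ^ m)) sums (LINT w|disc_measure. h k w * F w)"
      by (rule disc_integral_truncated_power_series[OF h1 h0 _ _ F \<rho>, where e = "\<lambda>w. w"]) auto
    moreover have "(\<lambda>m. if m = n then a m * (LINT w|disc_measure. h k w * w ^ m) else 0) sums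
        (a n * (LINT w|disc_measure. h k w * w ^ n))"
      by (rule sums_single)
    moreover have "(\<lambda>m. if m = n then a m * (LINT w|disc_measure. h k w * w ^ m) else 0)
        = (\<lambda>m. a m * (LINT w|disc_measure. h k w * w ^ m))"
      by (rule ext) (use z1 in auto)
    ultimately have 1: "(LINT w|disc_measure. h k w * F w) = a n * (LINT w|disc_measure. h k w * w ^ n)"
      by (simp only: sums_unique2)
    have "(\<lambda>m. b m * (LINT w|disc_measure. h k w * cnj w ^ m)) sums (LINT w|disc_measure. h k w * G w)"
      by (rule disc_integral_truncated_power_series[OF h1 h0 borel_measurable_cnj _ G \<rho>]) auto
    moreover have "(\<lambda>m. b m * (LINT w|disc_measure. h k w * cnj w ^ m)) sums
        (if n = 0 then b n * (LINT w|disc_measure. h k w * w ^ n) else 0)"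
    proof (cases "n = 0")
      case True
      have "(\<lambda>m. if m = 0 then b m * (LINT w|disc_measure. h k w * cnj w ^ m) else 0) sums
          (b 0 * (LINT w|disc_measure. h k w * cnj w ^ 0))"
        by (rule sums_single)
      moreover have "(\<lambda>m. if m = 0 then b m * (LINT w|disc_measure. h k w * cnj w ^ m) else 0)
          = (\<lambda>m. b m * (LINT w|disc_measure. h k w * cnj w ^ m))"
        by (rule ext) (use z2 in auto)
      ultimately show ?thesis using True by simp
    next
      case False
      then have "(\<lambda>m. b m * (LINT w|disc_measure. h k w * cnj w ^ m)) = (\<lambda>_. 0)"
        by (intro ext) (use z2 in auto)
      then show ?thesis using False by simp
    qed
    ultimately have 2: "(LINT w|disc_measure. h k w * G w) = (if n = 0 then b n * (LINT w|disc_measure. h k w * w ^ n) else 0)"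
      by (rule sums_unique2)
    have "(LINT w|disc_measure. h k w * u w) = (LINT w|disc_measure. h k w * F w + h k w * G w)"
      by (rule Bochner_Integration.integral_cong) (auto simp: FG algebra_simps)
    also have "\<dots> = (LINT w|disc_measure. h k w * F w) + (LINT w|disc_measure. h k w * G w)"
      by (intro Bochner_Integration.integral_add hi cont)
    finally show ?thesis unfolding 1 2 C_def by (simp add: algebra_simps)
  qed
  have L1: "(\<lambda>k. LINT w|disc_measure. h k w * u w) \<longlonglongrightarrow> (LINT w|disc_measure. cnj w ^ n * u w)"
    using disc_integral_truncation_tendsto[OF u, of n] by (simp add: h_def \<rho>_def)
  have "integrable disc_measure (\<lambda>w. w ^ n)"
    by (rule integrable_disc_bounded[where B = 1]) (auto simp: norm_power power_le_one intro!: borel_measurable_disc_measure)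
  from disc_integral_truncation_tendsto[OF this, of n]
  have "(\<lambda>k. LINT w|disc_measure. h k w * w ^ n) \<longlonglongrightarrow> (LINT w|disc_measure. cnj w ^ n * w ^ n)"
    by (simp add: h_def \<rho>_def)
  then have "(\<lambda>k. C * (LINT w|disc_measure. h k w * w ^ n)) \<longlonglongrightarrow> C * (LINT w|disc_measure. cnj w ^ n * w ^ n)"
    by (intro tendsto_mult tendsto_const)
  moreover have "eventually (\<lambda>k. C * (LINT w|disc_measure. h k w * w ^ n) = (LINT w|disc_measure. h k w * u w)) sequentially"
    using eventually_gt_at_top[of 0] by eventually_elim (simp add: trunc)
  ultimately have "(\<lambda>k. LINT w|disc_measure. h k w * u w) \<longlonglongrightarrow> C * (LINT w|disc_measure. cnj w ^ n * w ^ n)"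
    by (rule Lim_transform_eventually)
  with L1 have "(LINT w|disc_measure. cnj w ^ n * u w) = C * (LINT w|disc_measure. cnj w ^ n * w ^ n)"
    by (rule LIMSEQ_unique)
  moreover have "(LINT w|disc_measure. cnj w ^ n * w ^ n) = 1 / of_nat (Suc n)"
  proof -
    have "(LINT w|disc_measure. cnj w ^ n * w ^ n) = (LINT w|disc_measure. quasihom 0 (\<lambda>_. 1) w * w ^ n * cnj w ^ n)"
      by (simp add: quasihom_def mult_ac)
    also have "\<dots> = 2 / (of_nat (n + n) + 2)"
      using radius_power_integral[of "n + n"] by (subst disc_integral_quasihom_powers) auto
    also have "\<dots> = (2 * 1) / (2 * of_nat (Suc n))" by (simp add: algebra_simps)
    also have "\<dots> = 1 / of_nat (Suc n)" by (rule mult_divide_mult_cancel_left) simp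
    finally show ?thesis .
  qed
  ultimately show ?thesis by (simp add: C_def mult.commute)
qed

text \<open>The sum of the holomorphic Bergman kernel and its conjugate, minus \<open>1\<close>
  because the constants belong to both halves of the space. The value off the disc follows the
  convention of \<open>harmonic_bergman\<close>.\<close>

definition bergman_kernel :: "complex \<Rightarrow> complex \<Rightarrow> complex" where
  "bergman_kernel z w =
     (if w \<in> unit_disc then 1 / (1 - z * cnj w)\<^sup>2 + 1 / (1 - cnj z * w)\<^sup>2 - 1 else 0)"

lemma cnj_bergman_kernel [simp]: "cnj (bergman_kernel z w) = bergman_kernel z w"
  by (simp add: bergman_kernel_def)

lemma bergman_kernel_commute:
  "z \<in> unit_disc \<Longrightarrow> w \<in> unit_disc \<Longrightarrow> bergman_kernel z w = bergman_kernel w z"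
  by (simp add: bergman_kernel_def mult.commute)

lemma norm_mult_less_1:
  fixes z w :: complex
  shows "norm z < 1 \<Longrightarrow> norm w < 1 \<Longrightarrow> norm (z * w) < 1"
  using mult_strict_mono[of "norm z" 1 "norm w" 1] by (cases "z = 0") (auto simp: norm_mult)

lemma harmonic_on_imp_continuous_on:
  assumes "open S" "harmonic_on u S"
  shows "continuous_on S u"
proof -
  have "u differentiable (at z)" if "z \<in> S" for z
    using assms(2) that unfolding harmonic_on_def by blast
  then show ?thesis
    by (auto intro!: continuous_at_imp_continuous_on differentiable_imp_continuous_within)
qed

lemma bounded_harmonic_in_bergman:
  assumes "harmonic_on u unit_disc" "\<And>w. w \<notin> unit_disc \<Longrightarrow> u w = 0" "\<And>w. w \<in> unit_disc \<Longrightarrow> norm (u w) \<le> B"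
  shows "u \<in> harmonic_bergman"
proof -
  have [measurable]: "u \<in> borel_measurable disc_measure"
    using assms(1) by (intro borel_measurable_disc_continuous harmonic_on_imp_continuous_on) auto
  have "integrable disc_measure (\<lambda>w. (norm (u w))\<^sup>2)"
    by (rule disc.integrable_const_bound[where B = "B\<^sup>2"]) (auto intro!: power_mono assms(3))
  then show ?thesis
    using assms(1,2) unfolding harmonic_bergman_def by blast
qed

lemma bergman_integrable:
  assumes "u \<in> harmonic_bergman"
  shows "integrable disc_measure u"
proof -
  have h: "harmonic_on u unit_disc" and i: "integrable disc_measure (\<lambda>w. (norm (u w))\<^sup>2)"
    using assms unfolding harmonic_bergman_def by blast+
  have m: "u \<in> borel_measurable disc_measure"
    using h by (intro borel_measurable_disc_continuous harmonic_on_imp_continuous_on) auto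
  have "integrable disc_measure (\<lambda>w. 1 + (norm (u w))\<^sup>2)"
    using i by simp
  then show ?thesis
  proof (rule Bochner_Integration.integrable_bound)
    show "AE w in disc_measure. norm (u w) \<le> norm (1 + (norm (u w))\<^sup>2)"
    proof (intro AE_I2)
      fix w
      have "0 \<le> (norm (u w) - 1)\<^sup>2 + (norm (u w))\<^sup>2" by simp
      then show "norm (u w) \<le> norm (1 + (norm (u w))\<^sup>2)"
        by (simp add: power2_eq_square algebra_simps)
    qed
  qed (rule m)
qed

lemma bergman_kernel_in_bergman:
  assumes "z \<in> unit_disc"
  shows "bergman_kernel z \<in> harmonic_bergman"
proof (rule bounded_harmonic_in_bergman)
  have lt: "norm (z * cnj w) < 1" "norm (cnj z * w) < 1" if "w \<in> unit_disc" for w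
    using assms that norm_mult_less_1[of z "cnj w"] norm_mult_less_1[of "cnj z" w] by auto
  have ne: "1 - z * cnj w \<noteq> 0" "1 - cnj z * w \<noteq> 0" if "w \<in> unit_disc" for w
    using lt[OF that] by auto
  show "harmonic_on (bergman_kernel z) unit_disc"
  proof (rule harmonic_on_holomorphic_sum)
    show "(\<lambda>w. 1 / (1 - cnj z * w)\<^sup>2 - 1) holomorphic_on unit_disc" "(\<lambda>w. 1 / (1 - cnj z * w)\<^sup>2) holomorphic_on unit_disc"
      using ne by (auto intro!: holomorphic_intros)
  qed (auto simp: bergman_kernel_def)
  show "bergman_kernel z w = 0" if "w \<notin> unit_disc" for w
    using that by (simp add: bergman_kernel_def)
  fix w assume w: "w \<in> unit_disc"
  have bd: "norm (1 / (1 - x)\<^sup>2) \<le> 1 / (1 - norm z)\<^sup>2" if "norm x \<le> norm z" for x :: complex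
  proof -
    have "1 - norm z \<le> norm (1 - x)"
      using that norm_triangle_ineq2[of 1 x] by simp
    then show ?thesis
      using assms by (auto simp: norm_divide norm_power intro!: divide_left_mono power_mono mult_pos_pos)
  qed
  have "norm (bergman_kernel z w) \<le> norm (1 / (1 - z * cnj w)\<^sup>2 + 1 / (1 - cnj z * w)\<^sup>2) + norm (1::complex)"
    using w unfolding bergman_kernel_def by (simp only: if_True) (rule norm_triangle_ineq4)
  also have "\<dots> \<le> norm (1 / (1 - z * cnj w)\<^sup>2) + norm (1 / (1 - cnj z * w)\<^sup>2) + norm (1::complex)"
    by (intro add_right_mono norm_triangle_ineq)
  also have "\<dots> \<le> 1 / (1 - norm z)\<^sup>2 + 1 / (1 - norm z)\<^sup>2 + 1"
    using w by (intro add_mono bd) (auto simp: norm_mult mult_left_le)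
  finally show "norm (bergman_kernel z w) \<le> 1 / (1 - norm z)\<^sup>2 + 1 / (1 - norm z)\<^sup>2 + 1" .
qed

text \<open>Both rational terms are expanded by
  \<open>1 / (1 - x)\<^sup>2 = (\<Sum>n. (n + 1) * x ^ n)\<close>. The integral of \<open>h\<close>
  is added on the right to undo the \<open>-1\<close> of the kernel, so that the series keeps one
  uniform term.\<close>

lemma integral_bergman_kernel_sums:
  assumes h: "integrable disc_measure h" and z: "z \<in> unit_disc"
  shows "(\<lambda>n. of_nat (Suc n) * (z ^ n * (LINT w|disc_measure. h w * cnj w ^ n)
      + cnj z ^ n * (LINT w|disc_measure. h w * w ^ n)))
    sums ((LINT w|disc_measure. h w * bergman_kernel z w) + (LINT w|disc_measure. h w))"
proof -
  \<comment> \<open>Both halves at once: \<open>x\<close> is \<open>z\<close> with \<open>e\<close>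
    conjugation, or \<open>cnj z\<close> with \<open>e\<close> the identity.\<close>
  have *: "(\<lambda>n. (of_nat (Suc n) * x ^ n) * (LINT w|disc_measure. h w * e w ^ n))
      sums (LINT w|disc_measure. h w * (1 / (1 - x * e w)\<^sup>2))"
    and **: "integrable disc_measure (\<lambda>w. h w * (1 / (1 - x * e w)\<^sup>2))"
    if x: "norm x = norm z" and e [measurable]: "e \<in> borel_measurable borel" and en: "\<And>w. norm (e w) = norm w" for x e
  proof -
    have x1: "norm x < 1" using x z by simp
    have s: "summable (\<lambda>n. norm (of_nat (Suc n) * x ^ n))"
      using sums_summable[OF geometric_deriv_sums[of "norm x"]] x1 by (simp add: norm_mult norm_power del: of_nat_Suc)
    have g: "(\<Sum>n. (of_nat (Suc n) * x ^ n) * e w ^ n) = 1 / (1 - x * e w)\<^sup>2" if "w \<in> unit_disc" for w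
      using geometric_deriv_sums[of "x * e w"] norm_mult_less_1[of x "e w"] x1 that
      by (simp add: sums_iff power_mult_distrib mult.assoc en del: of_nat_Suc)
    have "(\<lambda>n. (of_nat (Suc n) * x ^ n) * (LINT w|disc_measure. h w * e w ^ n)) sums
       (LINT w|disc_measure. h w * (\<Sum>n. (of_nat (Suc n) * x ^ n) * e w ^ n))"
      by (rule disc_integral_power_series[OF h s]) (auto simp: norm_power en power_le_one)
    also have "(LINT w|disc_measure. h w * (\<Sum>n. (of_nat (Suc n) * x ^ n) * e w ^ n)) = (LINT w|disc_measure. h w * (1 / (1 - x * e w)\<^sup>2))"
      by (rule Bochner_Integration.integral_cong) (simp_all only: g space_disc_measure)
    finally show "(\<lambda>n. (of_nat (Suc n) * x ^ n) * (LINT w|disc_measure. h w * e w ^ n))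
      sums (LINT w|disc_measure. h w * (1 / (1 - x * e w)\<^sup>2))" .
    have hm [measurable]: "h \<in> borel_measurable disc_measure" using h by simp
    have em [measurable]: "e \<in> borel_measurable disc_measure" using e by (rule borel_measurable_disc_measure)
    have "integrable disc_measure (\<lambda>w. (1 / (1 - norm z)\<^sup>2) *\<^sub>R h w)" using h by simp
    then show "integrable disc_measure (\<lambda>w. h w * (1 / (1 - x * e w)\<^sup>2))"
    proof (rule Bochner_Integration.integrable_bound)
      show "AE w in disc_measure. norm (h w * (1 / (1 - x * e w)\<^sup>2)) \<le> norm ((1 / (1 - norm z)\<^sup>2) *\<^sub>R h w)"
      proof (rule AE_I2)
        fix w assume w: "w \<in> space disc_measure"
        have "1 - norm z \<le> norm (1 - x * e w)"
          using w norm_triangle_ineq2[of 1 "x * e w"] mult_left_le[of "norm w" "norm z"]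
          by (simp add: norm_mult x en)
        then have "1 / (norm (1 - x * e w))\<^sup>2 \<le> 1 / (1 - norm z)\<^sup>2"
          using z by (auto intro!: divide_left_mono power_mono mult_pos_pos)
        then show "norm (h w * (1 / (1 - x * e w)\<^sup>2)) \<le> norm ((1 / (1 - norm z)\<^sup>2) *\<^sub>R h w)"
          by (simp add: norm_mult norm_divide norm_power norm_inverse mult_right_mono divide_inverse mult.commute mult_left_mono)
      qed
    qed measurable
  qed
  have c: "norm (cnj z) = norm z" "norm z = norm z" by auto
  note A = *[OF c(2) borel_measurable_cnj] **[OF c(2) borel_measurable_cnj]
  have B: "(\<lambda>n. (of_nat (Suc n) * cnj z ^ n) * (LINT w|disc_measure. h w * w ^ n))
      sums (LINT w|disc_measure. h w * (1 / (1 - cnj z * w)\<^sup>2))"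
    "integrable disc_measure (\<lambda>w. h w * (1 / (1 - cnj z * w)\<^sup>2))"
    using *[OF c(1), of "\<lambda>w. w"] **[OF c(1), of "\<lambda>w. w"] by auto
  have "(LINT w|disc_measure. h w * bergman_kernel z w)
      = (LINT w|disc_measure. h w * (1 / (1 - z * cnj w)\<^sup>2) + h w * (1 / (1 - cnj z * w)\<^sup>2) - h w)"
    by (rule Bochner_Integration.integral_cong) (auto simp: bergman_kernel_def algebra_simps)
  also have "\<dots> = (LINT w|disc_measure. h w * (1 / (1 - z * cnj w)\<^sup>2)) + (LINT w|disc_measure. h w * (1 / (1 - cnj z * w)\<^sup>2)) - (LINT w|disc_measure. h w)"
    using A(2) B(2) h by (subst Bochner_Integration.integral_diff Bochner_Integration.integral_add; simp)+
  finally show ?thesis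
    using sums_add[OF A(1) B(1)] by (simp add: ring_distribs mult.assoc del: of_nat_Suc)
qed

lemma holomorphic_on_disc_power_series:
  assumes "F holomorphic_on unit_disc" "w \<in> unit_disc"
  shows "(\<lambda>n. (deriv ^^ n) F 0 / fact n * w ^ n) sums F w"
  using holomorphic_power_series[OF assms] by simp

text \<open>The moments of \<open>u\<close> against powers of \<open>w\<close> and of its conjugate
  are Taylor coefficients divided by \<open>n + 1\<close>, and the weight \<open>n + 1\<close> in
  the kernel expansion cancels that division. What results is the pair of Taylor series at
  \<open>z\<close> with the constant term once too often; the excess is the integral of
  \<open>u\<close>.\<close>

lemma bergman_kernel_reproducing:
  assumes u: "u \<in> harmonic_bergman" and z: "z \<in> unit_disc"
  shows "inner_L2 u (bergman_kernel z) = u z"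
proof -
  have ui: "integrable disc_measure u" by (rule bergman_integrable[OF u])
  have "harmonic_on u unit_disc" using u unfolding harmonic_bergman_def by blast
  then obtain F G where FG: "F holomorphic_on unit_disc" "G holomorphic_on unit_disc"
    and uFG: "\<And>w. w \<in> unit_disc \<Longrightarrow> u w = F w + cnj (G w)"
    using harmonic_on_imp_holomorphic_decomposition[of unit_disc u] by (metis convex_ball open_ball)
  define a where "a = (\<lambda>n. (deriv ^^ n) F 0 / fact n)"
  define b where "b = (\<lambda>n. (deriv ^^ n) G 0 / fact n)"
  have F: "(\<lambda>n. a n * w ^ n) sums F w" and G: "(\<lambda>n. b n * w ^ n) sums G w" if "w \<in> unit_disc" for w
    using holomorphic_on_disc_power_series[OF FG(1) that] holomorphic_on_disc_power_series[OF FG(2) that]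
    by (simp_all add: a_def b_def)
  have cF: "(\<lambda>n. cnj (a n) * cnj w ^ n) sums cnj (F w)" and cG: "(\<lambda>n. cnj (b n) * cnj w ^ n) sums cnj (G w)"
    if "w \<in> unit_disc" for w
    using F[OF that] G[OF that] unfolding sums_cnj[symmetric, of "\<lambda>n. a n * w ^ n"] sums_cnj[symmetric, of "\<lambda>n. b n * w ^ n"]
    by simp_all
  have cont: "continuous_on unit_disc F" "continuous_on unit_disc G"
    "continuous_on unit_disc (\<lambda>w. cnj (F w))" "continuous_on unit_disc (\<lambda>w. cnj (G w))"
    using FG[THEN holomorphic_on_imp_continuous_on] by (auto intro: continuous_on_cnj)
  have m1: "(LINT w|disc_measure. u w * cnj w ^ n) = (a n + (if n = 0 then cnj (b n) else 0)) / of_nat (Suc n)" for n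
    by (rule harmonic_moment[OF ui F cG uFG cont(1) cont(4)])
  \<comment> \<open>Conjugating \<open>u\<close> exchanges the roles of \<open>F\<close> and
    \<open>G\<close>, so the moments against \<open>w ^ n\<close> come from the same lemma.\<close>
  have "integrable disc_measure (\<lambda>w. cnj (u w))" using ui by simp
  then have "(LINT w|disc_measure. cnj (u w) * cnj w ^ n) = (b n + (if n = 0 then cnj (a n) else 0)) / of_nat (Suc n)" for n
    by (rule harmonic_moment[OF _ G cF _ cont(2) cont(3)]) (simp_all add: uFG)
  from arg_cong[OF this, of cnj]
  have m2: "(LINT w|disc_measure. u w * w ^ n) = (cnj (b n) + (if n = 0 then a n else 0)) / of_nat (Suc n)" for n
    by (simp flip: Bochner_Integration.integral_cnj add: if_distrib[of cnj] cong: if_cong)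
  \<comment> \<open>\<open>S\<close> records that the constant term is produced by both halves of
    the kernel.\<close>
  define S where "S = (\<lambda>n::nat. if n = 0 then a 0 + cnj (b 0) else 0)"
  have eq: "of_nat (Suc n) * (z ^ n * (LINT w|disc_measure. u w * cnj w ^ n) + cnj z ^ n * (LINT w|disc_measure. u w * w ^ n))
      = a n * z ^ n + cnj (b n) * cnj z ^ n + S n" for n
    unfolding m1 m2 by (cases "n = 0") (simp_all add: S_def distrib_left mult_ac del: of_nat_Suc, simp)
  have "(\<lambda>n. a n * z ^ n + cnj (b n) * cnj z ^ n + S n) sums (F z + cnj (G z) + (a 0 + cnj (b 0)))"
    unfolding S_def by (intro sums_add F[OF z] cG[OF z]) (rule sums_single[of 0 "\<lambda>_. a 0 + cnj (b 0)"])
  moreover have "(\<lambda>n. a n * z ^ n + cnj (b n) * cnj z ^ n + S n) sums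
      ((LINT w|disc_measure. u w * bergman_kernel z w) + (LINT w|disc_measure. u w))"
    using integral_bergman_kernel_sums[OF ui z] unfolding eq .
  moreover have "(LINT w|disc_measure. u w) = a 0 + cnj (b 0)" using m1[of 0] by simp
  ultimately have "(LINT w|disc_measure. u w * bergman_kernel z w) = F z + cnj (G z)"
    using sums_unique2 by fastforce
  then show ?thesis by (simp add: inner_L2_def uFG[OF z])
qed

text \<open>Uniqueness is the usual symmetry argument: \<open>k w\<close> is the inner product of
  \<open>k\<close> with the kernel at \<open>w\<close>, and the conjugate of that product is
  evaluated by the reproducing property of \<open>k\<close>. Off the disc both functions are
  \<open>0\<close> by convention.\<close>

lemma repr_kernel_eq_bergman_kernel:
  assumes z: "z \<in> unit_disc"
  shows "repr_kernel z = bergman_kernel z"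
  unfolding repr_kernel_def
proof (rule the_equality)
  show "bergman_kernel z \<in> harmonic_bergman \<and> (\<forall>u\<in>harmonic_bergman. u z = inner_L2 u (bergman_kernel z))"
    using bergman_kernel_in_bergman[OF z] bergman_kernel_reproducing[OF _ z] by auto
next
  fix k assume k: "k \<in> harmonic_bergman \<and> (\<forall>u\<in>harmonic_bergman. u z = inner_L2 u k)"
  show "k = bergman_kernel z"
  proof
    fix w
    show "k w = bergman_kernel z w"
    proof (cases "w \<in> unit_disc")
      case True
      have "k w = inner_L2 k (bergman_kernel w)"
        using k bergman_kernel_reproducing[OF _ True] by simp
      also have "\<dots> = cnj (inner_L2 (bergman_kernel w) k)"
        unfolding inner_L2_def Bochner_Integration.integral_cnj[symmetric] by (simp add: mult.commute)
      also have "inner_L2 (bergman_kernel w) k = bergman_kernel w z"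
        using k bergman_kernel_in_bergman[OF True] by simp
      finally show ?thesis using bergman_kernel_commute[OF True z] by simp
    next
      case False
      then have "k w = 0" using k unfolding harmonic_bergman_def by blast
      with False show ?thesis by (simp add: bergman_kernel_def)
    qed
  qed
qed

section \<open>Toeplitz operators on powers of \<open>z\<close>\<close>

definition disc_power :: "nat \<Rightarrow> complex \<Rightarrow> complex" where
  "disc_power n z = (if z \<in> unit_disc then z ^ n else 0)"

text \<open>The factor \<open>c\<close> lets the output of one Toeplitz operator, a multiple of a
  power, be fed directly to the next.\<close>

lemma scaled_disc_power_in_harmonic_poly: "(\<lambda>z. c * disc_power n z) \<in> harmonic_poly"
proof -
  have "(\<lambda>z. c * disc_power n z) = (\<lambda>z. if z \<in> unit_disc
      then \<Sum>k\<le>n. (if k = n then c else 0) * z ^ k + 0 * cnj z ^ k else 0)"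
    by (auto simp: disc_power_def fun_eq_iff if_distrib[of "\<lambda>x. x * _"] cong: if_cong)
  then show ?thesis
    unfolding harmonic_poly_def
    by (intro CollectI exI[of _ n] exI[of _ "\<lambda>k. if k = n then c else 0"] exI[of _ "\<lambda>_. 0"])
qed

lemma disc_power_in_bergman: "disc_power n \<in> harmonic_bergman"
proof (rule bounded_harmonic_in_bergman)
  show "harmonic_on (disc_power n) unit_disc"
    by (rule harmonic_on_holomorphic_sum[where F = "\<lambda>z. z ^ n" and G = "\<lambda>_. 0"])
       (auto simp: disc_power_def intro!: holomorphic_intros)
  show "norm (disc_power n w) \<le> 1" if "w \<in> unit_disc" for w
    using that by (simp add: disc_power_def norm_power power_le_one)
qed (simp add: disc_power_def)

text \<open>The exponent is real because the argument leaves the integers later. Since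
  \<open>radius_measure\<close> has density \<open>2 * r\<close>, this is twice the classical Mellin
  transform at \<open>a + 2\<close>.\<close>

definition mellin :: "(real \<Rightarrow> complex) \<Rightarrow> real \<Rightarrow> complex" where
  "mellin \<phi> a = (LINT r|radius_measure. \<phi> r * of_real (r powr a))"

text \<open>The integrands agree only almost everywhere: for instance, \<open>0 powr 0\<close> is
  \<open>0\<close> whereas \<open>0 ^ 0\<close> is \<open>1\<close>.\<close>

lemma mellin_of_nat:
  assumes [measurable]: "\<phi> \<in> borel_measurable borel"
  shows "mellin \<phi> (real n) = (LINT r|radius_measure. \<phi> r * of_real r ^ n)"
  unfolding mellin_def
proof (rule integral_cong_AE)
  show "AE r in radius_measure. \<phi> r * of_real (r powr real n) = \<phi> r * of_real r ^ n"
    using AE_radius_bounds by eventually_elim (simp add: powr_realpow)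
qed measurable

text \<open>After multiplication by \<open>w ^ m\<close> the symbol has degree \<open>N\<close>, so
  a single term of the kernel expansion survives and carries the weight \<open>N + 1\<close>. Taking
  \<open>N\<close> a natural number keeps the image holomorphic.\<close>

lemma toeplitz_poly_quasihom_disc_power:
  assumes i: "integrable disc_measure (quasihom k \<phi>)" and [measurable]: "\<phi> \<in> borel_measurable borel"
    and N: "int N = k + int m"
  shows "toeplitz_poly (quasihom k \<phi>) (\<lambda>z. c * disc_power m z)
     = (\<lambda>z. (c * of_nat (Suc N) * mellin \<phi> (real (m + N))) * disc_power N z)"
proof
  fix z
  define h where "h = (\<lambda>w. quasihom k \<phi> w * w ^ m)"
  show "toeplitz_poly (quasihom k \<phi>) (\<lambda>z. c * disc_power m z) z
     = (c * of_nat (Suc N) * mellin \<phi> (real (m + N))) * disc_power N z"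
  proof (cases "z \<in> unit_disc")
    case z: True
    have [measurable]: "quasihom k \<phi> \<in> borel_measurable disc_measure" using i by simp
    have [measurable]: "(\<lambda>w. w ^ m) \<in> borel_measurable disc_measure"
      by (rule borel_measurable_disc_measure) measurable
    have hi: "integrable disc_measure h"
      unfolding h_def
      by (rule Bochner_Integration.integrable_bound[OF i])
         (auto simp: norm_mult norm_power power_le_one mult_left_le)
    have m1: "(LINT w|disc_measure. h w * cnj w ^ n) = (if n = N then mellin \<phi> (real (m + N)) else 0)" for n
      using disc_integral_quasihom_powers[of \<phi> k m n] N by (auto simp: h_def mellin_of_nat simp del: of_nat_add)
    \<comment> \<open>The antiholomorphic half contributes only when the image is constant; this is
      the contribution removed by the \<open>-1\<close> of the kernel.\<close>
    have m2: "(LINT w|disc_measure. h w * w ^ n) = (if n = 0 \<and> N = 0 then mellin \<phi> (real (m + N)) else 0)" for n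
    proof -
      have "(LINT w|disc_measure. h w * w ^ n) = (LINT w|disc_measure. quasihom k \<phi> w * w ^ (m + n) * cnj w ^ 0)"
        by (simp add: h_def power_add mult_ac)
      also have "\<dots> = (if n = 0 \<and> N = 0 then mellin \<phi> (real (m + N)) else 0)"
        unfolding mellin_of_nat[OF assms(2)] using N by (subst disc_integral_quasihom_powers) auto
      finally show ?thesis .
    qed
    let ?M = "mellin \<phi> (real (m + N))"
    have "(\<lambda>n. (if n = N then of_nat (Suc N) * z ^ N * ?M else 0) + (if n = 0 then (if N = 0 then ?M else 0) else 0))
        sums (of_nat (Suc N) * z ^ N * ?M + (if N = 0 then ?M else 0))"
      by (intro sums_add sums_single[of N "\<lambda>_. of_nat (Suc N) * z ^ N * ?M"] sums_single[of 0 "\<lambda>_. if N = 0 then ?M else 0"])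
    moreover have "(\<lambda>n. (if n = N then of_nat (Suc N) * z ^ N * ?M else 0) + (if n = 0 then (if N = 0 then ?M else 0) else 0))
        = (\<lambda>n. of_nat (Suc n) * (z ^ n * (LINT w|disc_measure. h w * cnj w ^ n) + cnj z ^ n * (LINT w|disc_measure. h w * w ^ n)))"
      by (auto simp: m1 m2 fun_eq_iff)
    ultimately have "of_nat (Suc N) * z ^ N * ?M + (if N = 0 then ?M else 0)
        = (LINT w|disc_measure. h w * bergman_kernel z w) + (LINT w|disc_measure. h w)"
      using integral_bergman_kernel_sums[OF hi z] by (simp only: sums_unique2)
    moreover have "(LINT w|disc_measure. h w) = (if N = 0 then ?M else 0)"
      using m1[of 0] by auto
    ultimately have I: "(LINT w|disc_measure. h w * bergman_kernel z w) = of_nat (Suc N) * z ^ N * ?M"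
      by simp
    have "toeplitz_poly (quasihom k \<phi>) (\<lambda>z. c * disc_power m z) z
      = (LINT w|disc_measure. quasihom k \<phi> w * (c * disc_power m w) * bergman_kernel z w)"
      using z by (simp add: toeplitz_poly_def repr_kernel_eq_bergman_kernel)
    also have "\<dots> = (LINT w|disc_measure. c * (h w * bergman_kernel z w))"
      by (rule Bochner_Integration.integral_cong) (auto simp: h_def disc_power_def)
    also have "\<dots> = c * (of_nat (Suc N) * z ^ N * ?M)"
      by (simp only: integral_mult_right_zero I)
    finally show ?thesis using z by (simp add: disc_power_def)
  qed (simp add: toeplitz_poly_def disc_power_def)
qed

section \<open>Moments and Mellin transforms\<close>

text \<open>Weierstrass approximation on the values of \<open>X\<close>: the polynomial part
  integrates to \<open>0\<close>, and the error is at most \<open>e\<close> times the integral of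
  \<open>norm (g x)\<close>. A general \<open>X\<close> on an arbitrary measure space serves both
  powers of \<open>r\<close> on the line and products on a triple product space.\<close>

lemma integral_continuous_eq_0_if_moments_eq_0:
  fixes g :: "'a \<Rightarrow> complex" and X :: "'a \<Rightarrow> real" and c :: "real \<Rightarrow> real"
  assumes g: "integrable M g" and X [measurable]: "X \<in> borel_measurable M"
    and X01: "AE x in M. 0 \<le> X x \<and> X x \<le> 1"
    and mom: "\<And>n. (LINT x|M. g x * of_real (X x ^ n)) = 0"
    and c: "continuous_on {0..1} c" and cX [measurable]: "(\<lambda>x. c (X x)) \<in> borel_measurable M"
  shows "(LINT x|M. g x * of_real (c (X x))) = 0"
proof (rule ccontr)
  have gm [measurable]: "g \<in> borel_measurable M" using g by simp
  define I where "I = (LINT x|M. norm (g x))"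
  have I0: "0 \<le> I" unfolding I_def by simp
  assume ne: "(LINT x|M. g x * of_real (c (X x))) \<noteq> 0"
  \<comment> \<open>The \<open>+ 1\<close> avoids a zero denominator when \<open>I = 0\<close> and
    makes the final estimate strict.\<close>
  define e where "e = norm (LINT x|M. g x * of_real (c (X x))) / (I + 1)"
  have e: "0 < e" using ne I0 by (simp add: e_def)
  obtain q where q: "real_polynomial_function q" "\<And>x. x \<in> {0..1} \<Longrightarrow> \<bar>c x - q x\<bar> < e"
    using Stone_Weierstrass_real_polynomial_function[OF compact_Icc c e] by blast
  obtain a N where qa: "q = (\<lambda>x. \<Sum>i\<le>N. a i * x ^ i)"
    using q(1) real_polynomial_function_iff_sum by blast
  have iX: "integrable M (\<lambda>x. g x * of_real (X x ^ i))" for i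
    by (rule Bochner_Integration.integrable_bound[OF g], measurable, rule AE_mp[OF X01])
       (auto intro!: AE_I2 simp: norm_mult norm_power mult_left_le power_le_one)
  have gq: "g x * of_real (q (X x)) = (\<Sum>i\<le>N. of_real (a i) * (g x * of_real (X x ^ i)))" for x
    by (simp add: qa sum_distrib_left mult_ac)
  have iq: "integrable M (\<lambda>x. g x * of_real (q (X x)))"
    unfolding gq by (intro Bochner_Integration.integrable_sum integrable_mult_right iX)
  have q0: "(LINT x|M. g x * of_real (q (X x))) = 0"
    unfolding gq by (subst Bochner_Integration.integral_sum) (simp_all only: integrable_mult_right iX integral_mult_right_zero mom, simp)
  have "AE x in M. norm (g x * of_real (c (X x)) - g x * of_real (q (X x))) \<le> e * norm (g x)"
    using X01
  proof eventually_elim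
    fix x assume "0 \<le> X x \<and> X x \<le> 1"
    then have "\<bar>c (X x) - q (X x)\<bar> \<le> e" using q(2)[of "X x"] by simp
    moreover have "g x * of_real (c (X x)) - g x * of_real (q (X x)) = g x * of_real (c (X x) - q (X x))"
      by (simp add: algebra_simps)
    ultimately show "norm (g x * of_real (c (X x)) - g x * of_real (q (X x))) \<le> e * norm (g x)"
      using mult_left_mono[of "\<bar>c (X x) - q (X x)\<bar>" e "norm (g x)"]
      by (simp add: norm_mult mult.commute[of e] del: of_real_diff)
  qed
  note bd = this
  have qm [measurable]: "(\<lambda>x. g x * of_real (q (X x))) \<in> borel_measurable M" using iq by simp
  have eg: "integrable M (\<lambda>x. e * norm (g x))" using g by simp
  have id: "integrable M (\<lambda>x. g x * of_real (c (X x)) - g x * of_real (q (X x)))"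
    by (rule Bochner_Integration.integrable_bound[OF eg]) (use bd e in auto)
  have ic: "integrable M (\<lambda>x. g x * of_real (c (X x)))"
    using Bochner_Integration.integrable_add[OF id iq] by simp
  have "norm (LINT x|M. g x * of_real (c (X x))) = norm (LINT x|M. g x * of_real (c (X x)) - g x * of_real (q (X x)))"
    using ic iq q0 by simp
  also have "\<dots> \<le> (LINT x|M. e * norm (g x))"
    by (rule order_trans[OF integral_norm_bound integral_mono_AE[OF integrable_norm[OF id] eg bd]])
  also have "\<dots> = e * I" by (simp add: I_def)
  also have "\<dots> < e * (I + 1)" using e by simp
  also have "\<dots> = norm (LINT x|M. g x * of_real (c (X x)))"
    using I0 by (simp add: e_def)
  finally show False by simp
qed

text \<open>The positive and negative parts of \<open>g\<close> are densities of two finite measures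
  that agree on half-lines, hence everywhere; the densities then agree almost everywhere.\<close>

lemma AE_eq_0_if_integral_greaterThan_eq_0_real:
  fixes g :: "real \<Rightarrow> real"
  assumes M: "sets M = sets borel" and g: "integrable M g"
    and z: "\<And>x. (LINT r|M. g r * indicator {x<..} r) = 0"
  shows "AE r in M. g r = 0"
proof -
  have [measurable_cong]: "sets M = sets borel" by (rule M)
  have [measurable]: "g \<in> borel_measurable M" using g by simp
  have i: "integrable M (\<lambda>r. max 0 (g r))" "integrable M (\<lambda>r. max 0 (- g r))"
    using g by auto
  have fin: "(\<integral>\<^sup>+r. ennreal (max 0 (g r)) \<partial>M) \<noteq> \<infinity>" "(\<integral>\<^sup>+r. ennreal (max 0 (- g r)) \<partial>M) \<noteq> \<infinity>"
    using i by (simp_all add: nn_integral_eq_integral)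
  have e: "emeasure (density M (\<lambda>r. ennreal (max 0 (h r)))) {x<..} = ennreal (LINT r|M. max 0 (h r) * indicator {x<..} r)"
    if h: "integrable M h" for h x
  proof -
    have [measurable]: "h \<in> borel_measurable M" using h by simp
    have "emeasure (density M (\<lambda>r. ennreal (max 0 (h r)))) {x<..} = (\<integral>\<^sup>+r. ennreal (max 0 (h r)) * indicator {x<..} r \<partial>M)"
      by (rule emeasure_density) (auto simp: M)
    also have "\<dots> = (\<integral>\<^sup>+r. ennreal (max 0 (h r) * indicator {x<..} r) \<partial>M)"
      by (intro nn_integral_cong) (auto simp: indicator_def)
    also have "\<dots> = ennreal (LINT r|M. max 0 (h r) * indicator {x<..} r)"
      using h by (intro nn_integral_eq_integral) (auto intro!: integrable_real_mult_indicator simp: M)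
    finally show ?thesis .
  qed
  have "density M (\<lambda>r. ennreal (max 0 (g r))) = density M (\<lambda>r. ennreal (max 0 (- g r)))"
  proof (rule measure_eqI_lessThan)
    fix x
    show "emeasure (density M (\<lambda>r. ennreal (max 0 (g r)))) {x<..} < \<infinity>"
      unfolding e[OF g] by simp
    have "(LINT r|M. max 0 (g r) * indicator {x<..} r) - (LINT r|M. max 0 (- g r) * indicator {x<..} r)
        = (LINT r|M. max 0 (g r) * indicator {x<..} r - max 0 (- g r) * indicator {x<..} r)"
      using i by (subst Bochner_Integration.integral_diff) (auto intro!: integrable_real_mult_indicator simp: M)
    also have "\<dots> = (LINT r|M. g r * indicator {x<..} r)"
      by (rule Bochner_Integration.integral_cong) (auto simp: indicator_def)
    finally show "emeasure (density M (\<lambda>r. ennreal (max 0 (g r)))) {x<..} = emeasure (density M (\<lambda>r. ennreal (max 0 (- g r)))) {x<..}"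
      using z[of x] g unfolding e[OF g] by (subst e) auto
  qed (auto simp: M)
  then have "AE r in M. ennreal (max 0 (g r)) = ennreal (max 0 (- g r))"
    by (rule finite_density_unique[THEN iffD1, rotated -1]) (use fin in auto)
  then show ?thesis
    by eventually_elim (simp add: max_def split: if_splits)
qed

text \<open>With \<open>r powr b\<close> as the new variable, the power \<open>1 / b\<close>
  recovers \<open>r\<close>, so vanishing moments make all integrals against continuous functions
  vanish. Indicators of half-lines are limits of such functions, and real and imaginary parts are
  settled separately.\<close>

lemma AE_eq_0_if_moments_eq_0:
  fixes g :: "real \<Rightarrow> complex"
  assumes M: "sets M = sets borel" and g: "integrable M g"
    and M01: "AE r in M. 0 < r \<and> r < 1" and b: "0 < b"
    and mom: "\<And>n. (LINT r|M. g r * of_real ((r powr b) ^ n)) = 0"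
  shows "AE r in M. g r = 0"
proof -
  have [measurable_cong]: "sets M = sets borel" by (rule M)
  have gm [measurable]: "g \<in> borel_measurable M" using g by simp
  have cont: "(LINT r|M. g r * of_real (d r)) = 0" if d: "continuous_on UNIV d" for d :: "real \<Rightarrow> real"
  proof -
    have [measurable]: "d \<in> borel_measurable borel" using d by (rule borel_measurable_continuous_onI)
    have c: "continuous_on {0..1} (\<lambda>y. d (y powr (1 / b)))"
      by (rule continuous_on_compose2[OF d]) (use b in \<open>auto intro!: continuous_on_powr'\<close>)
    have "(LINT r|M. g r * of_real (d ((r powr b) powr (1 / b)))) = 0"
      by (rule integral_continuous_eq_0_if_moments_eq_0[OF g _ _ mom c], measurable, rule AE_mp[OF M01])
         (use b in \<open>auto intro!: AE_I2 simp: powr_le1\<close>)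
    also have "(LINT r|M. g r * of_real (d ((r powr b) powr (1 / b)))) = (LINT r|M. g r * of_real (d r))"
      by (rule integral_cong_AE, measurable, rule AE_mp[OF M01])
         (use b in \<open>auto intro!: AE_I2 simp: powr_powr\<close>)
    finally show ?thesis .
  qed
  have ind: "(LINT r|M. g r * of_real (indicator {x<..} r)) = 0" for x
  proof (rule LIMSEQ_unique)
    \<comment> \<open>A ramp of slope \<open>k\<close> that starts at \<open>x\<close> and is cut
      off at height \<open>1\<close>; it increases to the indicator of the half-line.\<close>
    define d where "d = (\<lambda>k r. min 1 (max 0 (real k * (r - x))))"
    have dm [measurable]: "d k \<in> borel_measurable borel" for k unfolding d_def by measurable
    have "(LINT r|M. g r * of_real (d k r)) = 0" for k
      by (rule cont) (auto simp: d_def intro!: continuous_intros)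
    then show "(\<lambda>k. LINT r|M. g r * of_real (d k r)) \<longlonglongrightarrow> 0" by simp
    show "(\<lambda>k. LINT r|M. g r * of_real (d k r)) \<longlonglongrightarrow> (LINT r|M. g r * of_real (indicator {x<..} r))"
    proof (rule integral_dominated_convergence[where w = "\<lambda>r. norm (g r)"])
      show "AE r in M. norm (g r * of_real (d k r)) \<le> norm (g r)" for k
        by (auto intro!: AE_I2 mult_left_le simp: norm_mult d_def)
      show "AE r in M. (\<lambda>k. g r * of_real (d k r)) \<longlonglongrightarrow> g r * of_real (indicator {x<..} r)"
      proof (intro AE_I2 tendsto_mult tendsto_const tendsto_of_real)
        fix r
        show "(\<lambda>k. d k r) \<longlonglongrightarrow> indicator {x<..} r"
        proof (cases "x < r")
          case True
          obtain k0 where "1 < real k0 * (r - x)" using True reals_Archimedean3[of "r - x"] by auto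
          then have "1 \<le> real k * (r - x)" if "k0 \<le> k" for k
            using that True by (smt (verit, best) mult_right_mono of_nat_le_iff)
          then have "eventually (\<lambda>k. indicator {x<..} r = d k r) sequentially"
            using True unfolding eventually_sequentially d_def by (intro exI[of _ k0]) auto
          then show ?thesis by (rule Lim_transform_eventually[OF tendsto_const])
        next
          case False
          then have "d k r = 0" for k by (simp add: d_def mult_nonneg_nonpos)
          then show ?thesis using False by simp
        qed
      qed
    qed (use g in auto)
  qed
  have gi: "integrable M (\<lambda>r. g r * of_real (indicator {x<..} r))" for x
    by (rule Bochner_Integration.integrable_bound[OF g]) (auto simp: norm_mult indicator_def)
  have "AE r in M. Re (g r) = 0"
  proof (rule AE_eq_0_if_integral_greaterThan_eq_0_real[OF M])
    show "integrable M (\<lambda>r. Re (g r))" using g by simp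
    have "(LINT r|M. Re (g r * of_real (indicator {x<..} r))) = 0" for x
      by (simp only: integral_Re[OF gi] ind zero_complex.simps)
    then show "(LINT r|M. Re (g r) * indicator {x<..} r) = 0" for x by simp
  qed
  moreover have "AE r in M. Im (g r) = 0"
  proof (rule AE_eq_0_if_integral_greaterThan_eq_0_real[OF M])
    show "integrable M (\<lambda>r. Im (g r))" using g by simp
    have "(LINT r|M. Im (g r * of_real (indicator {x<..} r))) = 0" for x
      by (simp only: integral_Im[OF gi] ind zero_complex.simps)
    then show "(LINT r|M. Im (g r) * indicator {x<..} r) = 0" for x by simp
  qed
  ultimately show ?thesis by eventually_elim (simp add: complex_eq_iff)
qed

section \<open>Products of transforms and the passage to real exponents\<close>

lemma
  fixes f :: "'a \<Rightarrow> complex" and g :: "'b \<Rightarrow> complex"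
  assumes "finite_measure M" "finite_measure N" and f: "integrable M f" and g: "integrable N g"
  shows integrable_pair_times: "integrable (M \<Otimes>\<^sub>M N) (\<lambda>p. f (fst p) * g (snd p))"
    and integral_pair_times: "(LINT p|(M \<Otimes>\<^sub>M N). f (fst p) * g (snd p)) = (LINT x|M. f x) * (LINT y|N. g y)"
proof -
  interpret M: finite_measure M by fact
  interpret N: finite_measure N by fact
  interpret pair_sigma_finite M N ..
  have [measurable]: "f \<in> borel_measurable M" "g \<in> borel_measurable N" using f g by simp_all
  show *: "integrable (M \<Otimes>\<^sub>M N) (\<lambda>p. f (fst p) * g (snd p))"
    by (rule Fubini_integrable) (use f g in \<open>auto simp: norm_mult\<close>)
  show "(LINT p|(M \<Otimes>\<^sub>M N). f (fst p) * g (snd p)) = (LINT x|M. f x) * (LINT y|N. g y)"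
    using integral_fst'[OF *] by simp
qed

lemma radius_integrable_bounded_factor:
  assumes f: "integrable radius_measure f" and w [measurable]: "w \<in> borel_measurable borel" and "\<And>r. \<bar>w r\<bar> \<le> 1"
  shows "integrable radius_measure (\<lambda>r. f r * complex_of_real (w r))"
proof -
  have [measurable]: "f \<in> borel_measurable radius_measure" using f by simp
  have [measurable]: "w \<in> borel_measurable radius_measure" using w by simp
  show ?thesis
    by (rule Bochner_Integration.integrable_bound[OF f])
       (use assms(3) in \<open>auto simp: norm_mult mult_left_le\<close>)
qed

text \<open>A product of three Mellin transforms is the transform of the image of a complex measure under
  \<open>(r, t, u) \<mapsto> (r t u)\<^sup>2\<close>, so an identity between two such products is an identity between moments.\<close>

lemma mellin_product_identity_extends:
  fixes f g :: "nat \<Rightarrow> real \<Rightarrow> complex"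
  assumes f: "\<And>i. integrable radius_measure (f i)" and g: "\<And>i. integrable radius_measure (g i)"
    and eq: "\<And>n::nat. mellin (f 0) (real (2 * n)) * (mellin (f 1) (real (2 * n)) * mellin (f 2) (real (2 * n)))
          = mellin (g 0) (real (2 * n)) * (mellin (g 1) (real (2 * n)) * mellin (g 2) (real (2 * n)))"
    and x: "0 < x"
  shows "mellin (f 0) (2 * x) * (mellin (f 1) (2 * x) * mellin (f 2) (2 * x))
          = mellin (g 0) (2 * x) * (mellin (g 1) (2 * x) * mellin (g 2) (2 * x))"
proof -
  define P where "P = radius_measure \<Otimes>\<^sub>M (radius_measure \<Otimes>\<^sub>M radius_measure)"
  \<comment> \<open>\<open>\<kappa>\<close> truncates to the unit interval. It changes nothing on a
    set of full measure and makes the bounds hold everywhere, so that no null sets of the triple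
    product have to be handled.\<close>
  define \<kappa> :: "real \<Rightarrow> real" where "\<kappa> = (\<lambda>r. max 0 (min 1 r))"
  \<comment> \<open>The square matches the spacing of the data: \<open>X p ^ n\<close> corresponds
    to exponent \<open>2 * n\<close>, and \<open>X p powr x\<close> to \<open>2 * x\<close>.\<close>
  define X where "X = (\<lambda>p. (\<kappa> (fst p) * (\<kappa> (fst (snd p)) * \<kappa> (snd (snd p))))\<^sup>2)"
  define T where "T = (\<lambda>(h::nat \<Rightarrow> real \<Rightarrow> complex) p. h 0 (fst p) * (h 1 (fst (snd p)) * h 2 (snd (snd p))))"
  have \<kappa>m [measurable]: "\<kappa> \<in> borel_measurable borel" unfolding \<kappa>_def by measurable
  have \<kappa>01: "0 \<le> \<kappa> r" "\<kappa> r \<le> 1" for r by (auto simp: \<kappa>_def)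
  have Xm [measurable]: "X \<in> borel_measurable P" unfolding X_def P_def by measurable
  have X01: "0 \<le> X p" "X p \<le> 1" for p
    unfolding X_def by (auto intro!: power_le_one mult_le_one mult_nonneg_nonneg simp: \<kappa>01)
  \<comment> \<open>The weight \<open>w\<close> is general because it will be an integer power, a
    real power and the constant \<open>1\<close>.\<close>
  have prod: "integrable P (\<lambda>p. T h p * of_real (w (fst p) * (w (fst (snd p)) * w (snd (snd p)))))"
     "(LINT p|P. T h p * of_real (w (fst p) * (w (fst (snd p)) * w (snd (snd p)))))
       = (LINT r|radius_measure. h 0 r * of_real (w r)) * ((LINT r|radius_measure. h 1 r * of_real (w r)) * (LINT r|radius_measure. h 2 r * of_real (w r)))"
    if h: "\<And>i. integrable radius_measure (h i)" and w: "w \<in> borel_measurable borel" "\<And>r. \<bar>w r\<bar> \<le> 1" for h and w :: "real \<Rightarrow> real"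
  proof -
    note i = radius_integrable_bounded_factor[OF h w]
    note R = radius.finite_measure_axioms
    note RR = finite_measure_pair_measure[OF R R]
    have e: "T h p * of_real (w (fst p) * (w (fst (snd p)) * w (snd (snd p))))
       = (h 0 (fst p) * of_real (w (fst p))) * ((h 1 (fst (snd p)) * of_real (w (fst (snd p)))) * (h 2 (snd (snd p)) * of_real (w (snd (snd p)))))" for p
      by (simp add: T_def)
    note j = integrable_pair_times[OF R R i[of 1] i[of 2]]
    show "integrable P (\<lambda>p. T h p * of_real (w (fst p) * (w (fst (snd p)) * w (snd (snd p)))))"
      unfolding e P_def using integrable_pair_times[OF R RR i[of 0] j] .
    show "(LINT p|P. T h p * of_real (w (fst p) * (w (fst (snd p)) * w (snd (snd p)))))
       = (LINT r|radius_measure. h 0 r * of_real (w r)) * ((LINT r|radius_measure. h 1 r * of_real (w r)) * (LINT r|radius_measure. h 2 r * of_real (w r)))"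
      unfolding e P_def using integral_pair_times[OF R RR i[of 0] j] integral_pair_times[OF R R i[of 1] i[of 2]] by simp
  qed
  have mel: "(LINT r|radius_measure. h r * of_real (\<kappa> r ^ (2 * n))) = mellin h (real (2 * n))"
    "(LINT r|radius_measure. h r * of_real (\<kappa> r powr (2 * x))) = mellin h (2 * x)"
    if h: "integrable radius_measure h" for h n
  proof -
    have [measurable]: "h \<in> borel_measurable radius_measure" using h by simp
    have k: "AE r in radius_measure. \<kappa> r = r \<and> r powr real (2 * n) = r ^ (2 * n)"
      using AE_radius_bounds by eventually_elim (auto simp: \<kappa>_def powr_realpow simp del: of_nat_mult)
    show "(LINT r|radius_measure. h r * of_real (\<kappa> r ^ (2 * n))) = mellin h (real (2 * n))"
      unfolding mellin_def
      by (rule integral_cong_AE, measurable, rule AE_mp[OF k]) (auto intro!: AE_I2 simp del: of_nat_mult)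
    show "(LINT r|radius_measure. h r * of_real (\<kappa> r powr (2 * x))) = mellin h (2 * x)"
      unfolding mellin_def
      by (rule integral_cong_AE, measurable, rule AE_mp[OF k]) (auto intro!: AE_I2 simp del: of_nat_mult)
  qed
  have Xn: "X p ^ n = \<kappa> (fst p) ^ (2 * n) * (\<kappa> (fst (snd p)) ^ (2 * n) * \<kappa> (snd (snd p)) ^ (2 * n))" for p n
    by (simp add: X_def power_mult_distrib flip: power_mult)
  have sq: "(y\<^sup>2) powr x = y powr (2 * x)" if "0 \<le> y" for y :: real
  proof (cases "y = 0")
    case False
    then have "y\<^sup>2 = y powr 2" using that powr_numeral[of y] by simp
    then show ?thesis by (simp add: powr_powr)
  qed simp
  have Xx: "X p powr x = \<kappa> (fst p) powr (2 * x) * (\<kappa> (fst (snd p)) powr (2 * x) * \<kappa> (snd (snd p)) powr (2 * x))" for p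
    unfolding X_def by (subst sq) (simp_all add: \<kappa>01 powr_mult)
  note pn = prod[where w = "\<lambda>r. \<kappa> r ^ (2 * n)" for n, folded Xn]
  note px = prod[where w = "\<lambda>r. \<kappa> r powr (2 * x)", folded Xx]
  have wn: "(\<lambda>r. \<kappa> r ^ (2 * n)) \<in> borel_measurable borel" "\<And>r. \<bar>\<kappa> r ^ (2 * n)\<bar> \<le> 1" for n
    by (auto simp: \<kappa>01 power_le_one)
  have wx: "(\<lambda>r. \<kappa> r powr (2 * x)) \<in> borel_measurable borel" "\<And>r. \<bar>\<kappa> r powr (2 * x)\<bar> \<le> 1"
    using x by (auto simp: \<kappa>01 powr_le1)
  have iT: "integrable P (T f)" "integrable P (T g)"
    using prod(1)[OF f, of "\<lambda>_. 1"] prod(1)[OF g, of "\<lambda>_. 1"] by simp_all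
  have "(LINT p|P. (T f p - T g p) * of_real (X p powr x)) = 0"
  proof (rule integral_continuous_eq_0_if_moments_eq_0[where X = X])
    show "integrable P (\<lambda>p. T f p - T g p)" using iT by simp
    show "(LINT p|P. (T f p - T g p) * of_real (X p ^ n)) = 0" for n
      unfolding left_diff_distrib
      by (subst Bochner_Integration.integral_diff[OF pn(1)[OF f wn] pn(1)[OF g wn]])
         (simp only: pn(2)[OF f wn] pn(2)[OF g wn] mel(1)[OF f] mel(1)[OF g] eq diff_self)
    \<comment> \<open>Positivity of \<open>x\<close> gives continuity at \<open>0\<close>.\<close>
    show "continuous_on {0..1} (\<lambda>y. y powr x)"
      using x by (intro continuous_on_powr' continuous_intros) auto
  qed (auto simp: X01)
  then have "(LINT p|P. T f p * of_real (X p powr x)) = (LINT p|P. T g p * of_real (X p powr x))"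
    unfolding left_diff_distrib
    by (subst (asm) Bochner_Integration.integral_diff[OF px(1)[OF f wx] px(1)[OF g wx]]) simp
  then show ?thesis
    unfolding px(2)[OF f wx] px(2)[OF g wx] mel(2)[OF f] mel(2)[OF g] .
qed

section \<open>Mellin transforms at complex exponents and their zeros\<close>

definition cmellin :: "(real \<Rightarrow> complex) \<Rightarrow> complex \<Rightarrow> complex" where
  "cmellin f z = (LINT r|radius_measure. f r * exp (z * of_real (ln r)))"

lemma cmellin_of_real:
  assumes "integrable radius_measure f"
  shows "cmellin f (of_real a) = mellin f a"
  unfolding cmellin_def mellin_def
proof (rule integral_cong_AE)
  have [measurable]: "f \<in> borel_measurable radius_measure" using assms by simp
  show "(\<lambda>r. f r * exp (of_real a * of_real (ln r))) \<in> borel_measurable radius_measure"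
    "(\<lambda>r. f r * of_real (r powr a)) \<in> borel_measurable radius_measure" by measurable
  show "AE r in radius_measure. f r * exp (of_real a * of_real (ln r)) = f r * of_real (r powr a)"
    using AE_radius_bounds by eventually_elim (simp add: powr_def flip: exp_of_real)
qed

text \<open>The derivative in the exponent has norm at most \<open>- L * exp (\<delta> * L)\<close>,
  and \<open>1 + t \<le> exp t\<close> with \<open>t = - (\<delta> * L)\<close> bounds this by
  \<open>1 / \<delta>\<close>. The bound does not depend on \<open>L\<close>, which stands for
  \<open>ln r\<close> and is unbounded below.\<close>

lemma exp_mult_ln_Lipschitz:
  assumes "0 < \<delta>" "L \<le> 0" "\<delta> < Re w" "\<delta> < Re z"
  shows "norm (exp (w * of_real L) - exp (z * of_real L)) \<le> (1 / \<delta>) * norm (w - z)"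
proof (rule field_differentiable_bound[where S = "{z. \<delta> < Re z}" and f' = "\<lambda>z. exp (z * of_real L) * of_real L"])
  show "convex {z. \<delta> < Re z}" by (rule convex_halfspace_Re_gt)
  show "((\<lambda>z. exp (z * of_real L)) has_field_derivative exp (v * of_real L) * of_real L) (at v within {z. \<delta> < Re z})" for v
    by (auto intro!: derivative_eq_intros)
  fix v :: complex assume v: "v \<in> {z. \<delta> < Re z}"
  have "\<delta> * (- L) * exp (\<delta> * L) \<le> exp (- (\<delta> * L)) * exp (\<delta> * L)"
    using exp_ge_add_one_self[of "- (\<delta> * L)"] by (intro mult_right_mono) auto
  then have "\<delta> * ((- L) * exp (\<delta> * L)) \<le> 1" by (simp flip: exp_add add: mult.assoc)
  then have "(- L) * exp (\<delta> * L) \<le> 1 / \<delta>" using assms(1) by (simp add: field_simps)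
  moreover have "(- L) * exp (Re v * L) \<le> (- L) * exp (\<delta> * L)"
    using assms(2) v by (intro mult_left_mono) (auto simp: mult_right_mono_neg)
  ultimately show "norm (exp (v * of_real L) * of_real L) \<le> 1 / \<delta>"
    using assms(2) by (simp add: norm_mult mult.commute)
qed (use assms in auto)

text \<open>Difference quotients of the exponential are bounded by \<open>1 / \<delta>\<close>
  uniformly in \<open>r\<close> once real parts exceed \<delta>, so dominated convergence
  differentiates under the integral.\<close>

lemma holomorphic_cmellin:
  assumes f: "integrable radius_measure f"
  shows "cmellin f holomorphic_on {z. 0 < Re z}"
proof -
  have [measurable]: "f \<in> borel_measurable radius_measure" using f by simp
  have ex: "integrable radius_measure (\<lambda>r. f r * exp (v * of_real (ln r)))" if v: "0 < Re v" for v
  proof (rule Bochner_Integration.integrable_bound[OF f])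
    show "AE r in radius_measure. norm (f r * exp (v * of_real (ln r))) \<le> norm (f r)"
      using AE_radius_bounds
      by eventually_elim (use v in \<open>auto simp: norm_mult intro!: mult_left_le mult_nonneg_nonpos\<close>)
  qed measurable
  have "\<exists>D. (cmellin f has_field_derivative D) (at z)" if z: "0 < Re z" for z
  proof -
    define \<delta> where "\<delta> = Re z / 2"
    have \<delta>: "0 < \<delta>" "\<delta> < Re z" using z by (auto simp: \<delta>_def)
    define D where "D = (LINT r|radius_measure. f r * (exp (z * of_real (ln r)) * of_real (ln r)))"
    have "((\<lambda>w. (cmellin f w - cmellin f z) / (w - z)) \<longlongrightarrow> D) (at z within {z. \<delta> < Re z})"
      unfolding tendsto_at_iff_sequentially
    proof (intro allI impI)
      fix Y assume Y: "\<forall>i. Y i \<in> {z. \<delta> < Re z} - {z}" "Y \<longlonglongrightarrow> z"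
      have lim: "(\<lambda>i. LINT r|radius_measure. f r * ((exp (Y i * of_real (ln r)) - exp (z * of_real (ln r))) / (Y i - z))) \<longlonglongrightarrow> D"
        unfolding D_def
      proof (rule integral_dominated_convergence[where w = "\<lambda>r. norm (f r) * (1 / \<delta>)"])
        show "integrable radius_measure (\<lambda>r. norm (f r) * (1 / \<delta>))" using f by simp
        show "AE r in radius_measure. (\<lambda>i. f r * ((exp (Y i * of_real (ln r)) - exp (z * of_real (ln r))) / (Y i - z)))
          \<longlonglongrightarrow> f r * (exp (z * of_real (ln r)) * of_real (ln r))"
        proof (intro AE_I2 tendsto_mult tendsto_const)
          fix r :: real
          have "((\<lambda>w. exp (w * of_real (ln r))) has_field_derivative exp (z * of_real (ln r)) * of_real (ln r)) (at z)"
            by (auto intro!: derivative_eq_intros)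
          then have "((\<lambda>w. (exp (w * of_real (ln r)) - exp (z * of_real (ln r))) / (w - z)) \<longlongrightarrow> exp (z * of_real (ln r)) * of_real (ln r)) (at z)"
            by (simp add: has_field_derivative_iff)
          then show "(\<lambda>i. (exp (Y i * of_real (ln r)) - exp (z * of_real (ln r))) / (Y i - z)) \<longlonglongrightarrow> exp (z * of_real (ln r)) * of_real (ln r)"
            using Y unfolding tendsto_at_iff_sequentially by (auto simp: o_def)
        qed
        show "AE r in radius_measure. norm (f r * ((exp (Y i * of_real (ln r)) - exp (z * of_real (ln r))) / (Y i - z))) \<le> norm (f r) * (1 / \<delta>)" for i
          using AE_radius_bounds
        proof eventually_elim
          fix r :: real assume r: "0 < r \<and> r < 1"
          have ne: "norm (Y i - z) > 0" and Yi: "\<delta> < Re (Y i)" using Y(1) by auto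
          have "norm (exp (Y i * of_real (ln r)) - exp (z * of_real (ln r))) \<le> (1 / \<delta>) * norm (Y i - z)"
            using r by (intro exp_mult_ln_Lipschitz \<delta> Yi) auto
          then have "norm ((exp (Y i * of_real (ln r)) - exp (z * of_real (ln r))) / (Y i - z)) \<le> 1 / \<delta>"
            using ne by (simp add: norm_divide divide_le_eq)
          then show "norm (f r * ((exp (Y i * of_real (ln r)) - exp (z * of_real (ln r))) / (Y i - z))) \<le> norm (f r) * (1 / \<delta>)"
            unfolding norm_mult by (rule mult_left_mono) simp
        qed
      qed measurable
      have quot: "(LINT r|radius_measure. f r * ((exp (Y i * of_real (ln r)) - exp (z * of_real (ln r))) / (Y i - z)))
          = (cmellin f (Y i) - cmellin f z) / (Y i - z)" for i
      proof -
        have "\<delta> < Re (Y i)" using Y(1) by auto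
        then have "0 < Re (Y i)" using \<delta>(1) by simp
        note ex[OF this] ex[OF z]
        then have "(LINT r|radius_measure. (f r * exp (Y i * of_real (ln r)) - f r * exp (z * of_real (ln r))) / (Y i - z))
            = (cmellin f (Y i) - cmellin f z) / (Y i - z)"
          unfolding cmellin_def by simp
        then show ?thesis by (simp add: right_diff_distrib)
      qed
      show "((\<lambda>w. (cmellin f w - cmellin f z) / (w - z)) \<circ> Y) \<longlonglongrightarrow> D"
        using lim unfolding quot o_def .
    qed
    then have "(cmellin f has_field_derivative D) (at z within {z. \<delta> < Re z})"
      by (simp add: has_field_derivative_iff)
    moreover have "at z within {z. \<delta> < Re z} = at z"
      using \<delta>(2) by (intro at_within_open open_halfspace_Re_gt) simp
    ultimately show ?thesis by (auto simp only:)
  qed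
  then show ?thesis
    by (subst holomorphic_on_open[OF open_halfspace_Re_gt]) simp
qed

lemma mellin_integrable:
  fixes f :: "real \<Rightarrow> complex"
  assumes f: "integrable radius_measure f" and a: "0 \<le> a"
  shows "integrable radius_measure (\<lambda>r. f r * of_real (r powr a))"
proof (rule Bochner_Integration.integrable_bound[OF f])
  have [measurable]: "f \<in> borel_measurable radius_measure" using f by simp
  show "(\<lambda>r. f r * of_real (r powr a)) \<in> borel_measurable radius_measure" by measurable
  show "AE r in radius_measure. norm (f r * of_real (r powr a)) \<le> norm (f r)"
    using AE_radius_bounds
    by eventually_elim (use a in \<open>auto simp: norm_mult intro!: mult_left_le powr_le1\<close>)
qed

text \<open>The function \<open>f r * r powr a\<close> has all its moments in
  \<open>r powr b\<close> equal to \<open>0\<close>, and \<open>r powr a\<close> has no zero on the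
  open interval. Values on one arithmetic progression thus determine a function.\<close>

lemma AE_eq_0_if_mellin_eq_0:
  assumes f: "integrable radius_measure f" and b: "0 < b" and a: "0 \<le> a"
    and m: "\<And>n::nat. mellin f (a + b * real n) = 0"
  shows "AE r in radius_measure. f r = 0"
proof -
  have [measurable]: "f \<in> borel_measurable radius_measure" using f by simp
  have "AE r in radius_measure. f r * of_real (r powr a) = 0"
  proof (rule AE_eq_0_if_moments_eq_0[OF sets_radius_measure mellin_integrable[OF f a] AE_radius_bounds b])
    fix n
    have "(LINT r|radius_measure. f r * of_real (r powr a) * of_real ((r powr b) ^ n)) = mellin f (a + b * real n)"
      unfolding mellin_def
    proof (rule integral_cong_AE)
      show "AE r in radius_measure. f r * of_real (r powr a) * of_real ((r powr b) ^ n) = f r * of_real (r powr (a + b * real n))"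
        using AE_radius_bounds
      proof eventually_elim
        fix r :: real assume "0 < r \<and> r < 1"
        then have "r powr (a + b * real n) = r powr a * (r powr b) ^ n"
          using powr_realpow[of "r powr b" n] by (simp add: powr_powr powr_add)
        then show "f r * of_real (r powr a) * of_real ((r powr b) ^ n) = f r * of_real (r powr (a + b * real n))"
          by simp
      qed
    qed measurable
    then show "(LINT r|radius_measure. f r * of_real (r powr a) * of_real ((r powr b) ^ n)) = 0"
      by (simp add: m)
  qed
  with AE_radius_bounds show ?thesis
    by eventually_elim auto
qed

text \<open>A nonconstant holomorphic function on the half-plane has countably many zeros. A
  constant transform has none, since it cannot vanish along the progression of positive
  integers.\<close>

lemma countable_mellin_zeros:
  assumes f: "integrable radius_measure f" and ne: "\<not> (AE r in radius_measure. f r = 0)"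
  shows "countable {a. 0 < a \<and> mellin f a = 0}"
proof -
  let ?H = "{z::complex. 0 < Re z}"
  have "countable {z \<in> ?H. cmellin f z = 0}"
  proof (cases "cmellin f constant_on ?H")
    case True
    then obtain c where c: "\<And>z. z \<in> ?H \<Longrightarrow> cmellin f z = c" by (auto simp: constant_on_def)
    obtain n where "mellin f (1 + 1 * real n) \<noteq> 0"
      using AE_eq_0_if_mellin_eq_0[OF f, of 1 1] ne by auto
    then have "cmellin f (of_real (1 + 1 * real n)) \<noteq> 0" unfolding cmellin_of_real[OF f] .
    moreover have "of_real (1 + 1 * real n) \<in> ?H" by simp
    ultimately have "c \<noteq> 0" using c by metis
    then have "{z \<in> ?H. cmellin f z = 0} = {}" using c by auto
    then show ?thesis by (simp only: countable_empty)
  next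
    case False
    \<comment> \<open>A countable union of closed half-planes, which supplies the
      \<open>fsigma\<close> condition of the theorem on zeros.\<close>
    have "?H = (\<Union>n. {z. inverse (real (Suc n)) \<le> Re z})"
    proof (intro equalityI subsetI)
      fix v assume "v \<in> ?H"
      then obtain n where "inverse (real (Suc n)) < Re v" using reals_Archimedean[of "Re v"] by auto
      then show "v \<in> (\<Union>n. {z. inverse (real (Suc n)) \<le> Re z})" by (auto intro: less_imp_le)
    next
      fix v assume "v \<in> (\<Union>n. {z. inverse (real (Suc n)) \<le> Re z})"
      then obtain n where "inverse (real (Suc n)) \<le> Re v" by auto
      moreover have "0 < inverse (real (Suc n))" by simp
      ultimately show "v \<in> ?H" unfolding mem_Collect_eq by (rule order_less_le_trans[rotated])
    qed
    then have "fsigma ?H"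
      by (simp only:) (intro fsigma.intros closed_halfspace_Re_ge)
    then show ?thesis
      using open_halfspace_Re_gt[of 0] convex_connected[OF convex_halfspace_Re_gt[of 0]]
      by (intro holomorphic_countable_zeros[OF holomorphic_cmellin[OF f] _ _ _ False])
  qed
  moreover have "of_real ` {a. 0 < a \<and> mellin f a = 0} \<subseteq> {z \<in> ?H. cmellin f z = 0}"
    using cmellin_of_real[OF f] by auto
  ultimately have "countable (complex_of_real ` {a. 0 < a \<and> mellin f a = 0})"
    by (rule countable_subset[rotated])
  then show ?thesis
    by (rule countable_image_inj_on) (auto simp: inj_on_def)
qed

section \<open>Commuting operators\<close>

lemma mellin_mult_powr: "mellin (\<lambda>r. f r * of_real (r powr a)) b = mellin f (a + b)"
  unfolding mellin_def by (simp add: powr_add mult.assoc)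

text \<open>Radial functions are only Lebesgue measurable, while \<open>radius_measure\<close> is an
  image measure on the Borel sets; a Borel representative makes the formulas for image measures
  applicable. Measurability is known for \<open>of_real r * \<phi> r\<close>, hence the division by
  \<open>r\<close>.\<close>

lemma radial_function_AE_eq_borel:
  assumes "radial_function \<phi>"
  obtains \<phi>' where "\<phi>' \<in> borel_measurable borel" "AE r in radius_measure. \<phi> r = \<phi>' r"
proof -
  define h where "h = (\<lambda>r. if r \<in> {0..<1} then of_real r * \<phi> r else 0)"
  have "(\<lambda>r. of_real r * \<phi> r) \<in> borel_measurable (lebesgue_on {0..<1})"
    using assms unfolding radial_function_def by simp
  then have h: "h \<in> borel_measurable lebesgue"
    unfolding h_def by (intro borel_measurable_if_I) auto
  have "(\<lambda>r. Re (h r)) \<in> borel_measurable lebesgue" "(\<lambda>r. Im (h r)) \<in> borel_measurable lebesgue"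
    using h by auto
  from this[THEN completion_ex_borel_measurable_real]
  obtain a b where ab: "a \<in> borel_measurable lborel" "b \<in> borel_measurable lborel"
    "AE r in lborel. Re (h r) = a r" "AE r in lborel. Im (h r) = b r"
    by blast
  show ?thesis
  proof
    show "(\<lambda>r. (of_real (a r) + \<i> * of_real (b r)) / of_real r) \<in> borel_measurable borel"
      using ab(1,2) by simp
    show "AE r in radius_measure. \<phi> r = (of_real (a r) + \<i> * of_real (b r)) / of_real r"
      unfolding AE_radius_measure_iff using ab(3,4)
    proof eventually_elim
      fix r assume "Re (h r) = a r" "Im (h r) = b r"
      then have e: "h r = of_real (a r) + \<i> * of_real (b r)" by (simp add: complex_eq_iff)
      show "0 < r \<and> r < 1 \<longrightarrow> \<phi> r = (of_real (a r) + \<i> * of_real (b r)) / of_real r"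
        by (simp add: h_def flip: e)
    qed
  qed
qed

text \<open>The two symbols agree almost everywhere, so they define the same integrals on harmonic
  polynomials. Hence the predicates \<open>bounded_extension\<close> coincide as functions, and the
  choice operator in \<open>toeplitz\<close> selects the same operator.\<close>

lemma
  assumes ae: "AE r in radius_measure. \<phi> r = \<phi>' r" and [measurable]: "\<phi>' \<in> borel_measurable borel"
    and sym: "toeplitz_symbol (quasihom k \<phi>)"
  shows quasihom_borel_integrable: "integrable disc_measure (quasihom k \<phi>')"
    and toeplitz_quasihom_cong: "toeplitz (quasihom k \<phi>) = toeplitz (quasihom k \<phi>')"
    and toeplitz_symbol_quasihom_cong: "toeplitz_symbol (quasihom k \<phi>')"
proof -
  have i: "integrable disc_measure (quasihom k \<phi>)" using sym unfolding toeplitz_symbol_def by blast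
  have [measurable]: "quasihom k \<phi> \<in> borel_measurable disc_measure" using i by simp
  have [measurable]: "quasihom k \<phi>' \<in> borel_measurable disc_measure"
    by (intro borel_measurable_disc_measure) simp
  have eq: "AE w in disc_measure. quasihom k \<phi> w = quasihom k \<phi>' w"
    using AE_disc_radialI[OF ae] by eventually_elim (simp add: quasihom_def)
  show i': "integrable disc_measure (quasihom k \<phi>')"
    using i eq by (subst integrable_cong_AE[symmetric, of "quasihom k \<phi>"]) auto
  have "toeplitz_poly (quasihom k \<phi>) u = toeplitz_poly (quasihom k \<phi>') u" if u: "u \<in> harmonic_poly" for u
  proof
    fix z
    show "toeplitz_poly (quasihom k \<phi>) u z = toeplitz_poly (quasihom k \<phi>') u z"
    proof (cases "z \<in> unit_disc")
      case True
      obtain N a b where u_eq: "u = (\<lambda>z. if z \<in> unit_disc then \<Sum>n\<le>(N::nat). a n * z ^ n + b n * cnj z ^ n else 0)"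
        using u unfolding harmonic_poly_def by blast
      have "continuous_on unit_disc (\<lambda>z. \<Sum>n\<le>N. a n * z ^ n + b n * cnj z ^ n)"
        by (intro continuous_intros)
      then have "continuous_on unit_disc u"
        by (rule continuous_on_eq) (simp add: u_eq)
      then have [measurable]: "u \<in> borel_measurable disc_measure" by (rule borel_measurable_disc_continuous)
      have [measurable]: "bergman_kernel z \<in> borel_measurable disc_measure"
        using bergman_integrable[OF bergman_kernel_in_bergman[OF True]] by simp
      have "(LINT w|disc_measure. quasihom k \<phi> w * u w * bergman_kernel z w)
          = (LINT w|disc_measure. quasihom k \<phi>' w * u w * bergman_kernel z w)"
        by (rule integral_cong_AE, measurable, rule AE_mp[OF eq]) (auto intro!: AE_I2)
      with True show ?thesis by (simp add: toeplitz_poly_def repr_kernel_eq_bergman_kernel)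
    qed (simp add: toeplitz_poly_def)
  qed
  then have e: "bounded_extension (quasihom k \<phi>) = bounded_extension (quasihom k \<phi>')"
    by (auto simp: bounded_extension_def fun_eq_iff)
  show "toeplitz (quasihom k \<phi>) = toeplitz (quasihom k \<phi>')" by (simp only: toeplitz_def e)
  show "toeplitz_symbol (quasihom k \<phi>')" using sym i' by (simp only: toeplitz_symbol_def e)
qed

lemma quasihom_integrable_imp_radius_integrable:
  assumes [measurable]: "\<phi> \<in> borel_measurable borel" and i: "integrable disc_measure (quasihom k \<phi>)"
  shows "integrable radius_measure \<phi>"
proof -
  have "integrable disc_measure (\<lambda>w. \<phi> (cmod w))"
    by (rule Bochner_Integration.integrable_bound[OF i])
       (auto intro!: borel_measurable_disc_measure simp: quasihom_def norm_mult)
  then show ?thesis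
    unfolding radius_measure_def by (subst integrable_distr_eq) auto
qed

lemma toeplitz_quasihom_disc_power:
  assumes "toeplitz_symbol (quasihom k \<phi>)" "\<phi> \<in> borel_measurable borel" "int N = k + int m"
  shows "toeplitz (quasihom k \<phi>) (\<lambda>z. c * disc_power m z)
     = (\<lambda>z. (c * of_nat (Suc N) * mellin \<phi> (real (m + N))) * disc_power N z)"
proof -
  have "\<exists>T. bounded_extension (quasihom k \<phi>) T" and i: "integrable disc_measure (quasihom k \<phi>)"
    using assms(1) unfolding toeplitz_symbol_def by blast+
  then have "bounded_extension (quasihom k \<phi>) (toeplitz (quasihom k \<phi>))"
    unfolding toeplitz_def by (intro someI_ex[of "bounded_extension (quasihom k \<phi>)"])
  then have "toeplitz (quasihom k \<phi>) (\<lambda>z. c * disc_power m z) = toeplitz_poly (quasihom k \<phi>) (\<lambda>z. c * disc_power m z)"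
    using scaled_disc_power_in_harmonic_poly unfolding bounded_extension_def by blast
  then show ?thesis
    using toeplitz_poly_quasihom_disc_power[OF i assms(2,3)] by simp
qed

text \<open>On the power of degree \<open>j + s\<close> both orders of the operators pass through
  holomorphic powers and end in degree \<open>j + p\<close>: one through degree \<open>j\<close>,
  the other through \<open>j + s + p\<close>. The last operator contributes \<open>j + p + 1\<close>
  on either side, and this factor cancels.\<close>

lemma commuting_imp_mellin_identity:
  fixes p s j :: nat
  assumes \<phi>: "toeplitz_symbol (quasihom (int p) \<phi>)" "\<phi> \<in> borel_measurable borel"
    and \<psi>: "toeplitz_symbol (quasihom (- int s) \<psi>)" "\<psi> \<in> borel_measurable borel"
    and com: "commuting (toeplitz (quasihom (int p) \<phi>)) (toeplitz (quasihom (- int s) \<psi>))"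
  shows "of_nat (j + 1) * mellin \<psi> (real (2 * j + s)) * mellin \<phi> (real (2 * j + p))
    = of_nat (j + s + p + 1) * mellin \<phi> (real (2 * j + 2 * s + p)) * mellin \<psi> (real (2 * j + 2 * p + s))"
proof -
  let ?S = "toeplitz (quasihom (int p) \<phi>)" and ?T = "toeplitz (quasihom (- int s) \<psi>)"
  let ?u = "\<lambda>z. 1 * disc_power (j + s) z"
  have ST: "?S (?T ?u) = (\<lambda>z. ((1 * of_nat (Suc j) * mellin \<psi> (real (j + s + j))) * of_nat (Suc (j + p))
      * mellin \<phi> (real (j + (j + p)))) * disc_power (j + p) z)"
    by (subst toeplitz_quasihom_disc_power[OF \<psi>, of j], simp, subst toeplitz_quasihom_disc_power[OF \<phi>, of "j + p"]) simp_all
  have TS: "?T (?S ?u) = (\<lambda>z. ((1 * of_nat (Suc (j + s + p)) * mellin \<phi> (real (j + s + (j + s + p)))) * of_nat (Suc (j + p))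
      * mellin \<psi> (real (j + s + p + (j + p)))) * disc_power (j + p) z)"
    by (subst toeplitz_quasihom_disc_power[OF \<phi>, of "j + s + p"], simp, subst toeplitz_quasihom_disc_power[OF \<psi>, of "j + p"]) simp_all
  have "?S (?T ?u) = ?T (?S ?u)"
    using com disc_power_in_bergman unfolding commuting_def by simp
  \<comment> \<open>Any nonzero point of the disc serves, since the power does not vanish
    there.\<close>
  from fun_cong[OF this[unfolded ST TS], of "1 / 2"]
  have "(of_nat (Suc j) * mellin \<psi> (real (j + s + j)) * mellin \<phi> (real (j + (j + p)))) * of_nat (Suc (j + p))
      = (of_nat (Suc (j + s + p)) * mellin \<phi> (real (j + s + (j + s + p))) * mellin \<psi> (real (j + s + p + (j + p)))) * of_nat (Suc (j + p))"
    by (simp add: disc_power_def mult_ac del: of_nat_Suc of_nat_add)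
  then have "of_nat (Suc j) * mellin \<psi> (real (j + s + j)) * mellin \<phi> (real (j + (j + p)))
      = of_nat (Suc (j + s + p)) * mellin \<phi> (real (j + s + (j + s + p))) * mellin \<psi> (real (j + s + p + (j + p)))"
    by (subst (asm) mult_right_cancel) (simp_all del: of_nat_Suc)
  moreover have "j + s + j = 2 * j + s" "j + (j + p) = 2 * j + p" "j + s + (j + s + p) = 2 * j + 2 * s + p"
    "j + s + p + (j + p) = 2 * j + 2 * p + s" "Suc j = j + 1" "Suc (j + s + p) = j + s + p + 1" by auto
  ultimately show ?thesis by (simp only:)
qed

lemma mellin_one_of_nat: "mellin (\<lambda>_. 1) (real (2 * n)) = 1 / of_nat (n + 1)"
proof -
  have "mellin (\<lambda>_. 1) (real (2 * n)) = 2 / (of_nat (2 * n) + 2)"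
    by (subst mellin_of_nat) (simp_all only: mult_1 radius_power_integral borel_measurable_const)
  also have "\<dots> = (2 * 1) / (2 * of_nat (n + 1))" by (simp add: algebra_simps)
  also have "\<dots> = 1 / of_nat (n + 1)" by (rule mult_divide_mult_cancel_left) simp
  finally show ?thesis .
qed

text \<open>The weights \<open>1 / (j + 1)\<close> and \<open>1 / (j + s + p + 1)\<close> are themselves values of the Mellin transform
  of the constant \<open>1\<close>, which puts the identity into the form required by
  \<open>mellin_product_identity_extends\<close>.\<close>

lemma commuting_imp_mellin_identity_real:
  fixes p s :: nat and v :: real
  assumes \<phi>: "toeplitz_symbol (quasihom (int p) \<phi>)" "\<phi> \<in> borel_measurable borel" "integrable radius_measure \<phi>"
    and \<psi>: "toeplitz_symbol (quasihom (- int s) \<psi>)" "\<psi> \<in> borel_measurable borel" "integrable radius_measure \<psi>"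
    and com: "commuting (toeplitz (quasihom (int p) \<phi>)) (toeplitz (quasihom (- int s) \<psi>))"
    and v: "0 < v"
  shows "mellin \<psi> (s + v) * mellin (\<lambda>_. 1) (2 * s + 2 * p + v) * mellin \<phi> (p + v)
    = mellin \<psi> (2 * p + s + v) * mellin (\<lambda>_. 1) v * mellin \<phi> (2 * s + p + v)"
proof -
  \<comment> \<open>Powers of \<open>r\<close> absorb the constant parts of the arguments, so that
    all six transforms are taken at the common point \<open>2 * j\<close>.\<close>
  define f where "f = (\<lambda>(i::nat) r. if i = 0 then \<psi> r * complex_of_real (r powr s)
    else if i = 1 then \<phi> r * of_real (r powr p) else 1 * of_real (r powr (2 * s + 2 * p)))"
  define g where "g = (\<lambda>(i::nat) r. if i = 0 then \<psi> r * complex_of_real (r powr (2 * p + s))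
    else if i = 1 then \<phi> r * of_real (r powr (2 * s + p)) else 1 * of_real (r powr 0))"
  have one: "integrable radius_measure (\<lambda>_. 1 :: complex)" by simp
  have F: "f 0 = (\<lambda>r. \<psi> r * of_real (r powr s))" "f 1 = (\<lambda>r. \<phi> r * of_real (r powr p))"
      "f 2 = (\<lambda>r. 1 * of_real (r powr (2 * s + 2 * p)))"
    and G: "g 0 = (\<lambda>r. \<psi> r * of_real (r powr (2 * p + s)))" "g 1 = (\<lambda>r. \<phi> r * of_real (r powr (2 * s + p)))"
      "g 2 = (\<lambda>r. 1 * of_real (r powr 0))"
    by (simp_all add: f_def g_def)
  have fi: "integrable radius_measure (f i)" for i
    using mellin_integrable[OF \<psi>(3), of s] mellin_integrable[OF \<phi>(3), of p]
      mellin_integrable[OF one, of "2 * s + 2 * p"]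
    by (cases "i = 0"; cases "i = 1") (simp_all add: f_def)
  have gi: "integrable radius_measure (g i)" for i
    using mellin_integrable[OF \<psi>(3), of "2 * p + s"] mellin_integrable[OF \<phi>(3), of "2 * s + p"]
      mellin_integrable[OF one, of 0]
    by (cases "i = 0"; cases "i = 1") (simp_all add: g_def)
  have mf: "mellin (f 0) a = mellin \<psi> (s + a)" "mellin (f 1) a = mellin \<phi> (p + a)"
      "mellin (f 2) a = mellin (\<lambda>_. 1) (2 * s + 2 * p + a)"
    and mg: "mellin (g 0) a = mellin \<psi> (2 * p + s + a)" "mellin (g 1) a = mellin \<phi> (2 * s + p + a)"
      "mellin (g 2) a = mellin (\<lambda>_. 1) (0 + a)" for a :: real
    unfolding F G mellin_mult_powr by (rule refl)+
  have "mellin (f 0) (2 * (v / 2)) * (mellin (f 1) (2 * (v / 2)) * mellin (f 2) (2 * (v / 2)))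
      = mellin (g 0) (2 * (v / 2)) * (mellin (g 1) (2 * (v / 2)) * mellin (g 2) (2 * (v / 2)))"
  proof (rule mellin_product_identity_extends[OF fi gi])
    fix j :: nat
    define A where "A = mellin \<psi> (real (2 * j + s)) * mellin \<phi> (real (2 * j + p))"
    define B where "B = mellin \<phi> (real (2 * j + 2 * s + p)) * mellin \<psi> (real (2 * j + 2 * p + s))"
    have "of_nat (j + 1) * A = of_nat (j + s + p + 1) * B"
      using commuting_imp_mellin_identity[OF \<phi>(1,2) \<psi>(1,2) com, of j] by (simp only: A_def B_def mult.assoc)
    \<comment> \<open>Division by both linear factors exchanges them: the side that had
      \<open>j + 1\<close> now carries the transform of \<open>1\<close> at
      \<open>2 * (j + s + p)\<close>.\<close>
    then have AB: "A * (1 / of_nat (j + s + p + 1)) = B * (1 / of_nat (j + 1))"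
      by (simp add: field_simps del: of_nat_Suc of_nat_add)
    have "mellin (f 0) (real (2 * j)) = mellin \<psi> (real (2 * j + s))"
      "mellin (f 1) (real (2 * j)) = mellin \<phi> (real (2 * j + p))"
      "mellin (f 2) (real (2 * j)) = mellin (\<lambda>_. 1) (real (2 * (j + s + p)))"
      "mellin (g 0) (real (2 * j)) = mellin \<psi> (real (2 * j + 2 * p + s))"
      "mellin (g 1) (real (2 * j)) = mellin \<phi> (real (2 * j + 2 * s + p))"
      "mellin (g 2) (real (2 * j)) = mellin (\<lambda>_. 1) (real (2 * j))"
      unfolding mf mg by (rule arg_cong[where f = "mellin _"], simp)+
    then show "mellin (f 0) (real (2 * j)) * (mellin (f 1) (real (2 * j)) * mellin (f 2) (real (2 * j)))
        = mellin (g 0) (real (2 * j)) * (mellin (g 1) (real (2 * j)) * mellin (g 2) (real (2 * j)))"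
      using AB unfolding A_def B_def mellin_one_of_nat by (simp only: mult_ac)
  qed (use v in simp)
  then show ?thesis unfolding mf mg by (simp add: mult_ac)
qed

text \<open>Each integer translate of the bad set is countable, and so is their union, which cannot
  cover the interval from \<open>0\<close> to \<open>1\<close>.\<close>

lemma exists_shift_avoiding_countable:
  fixes Z :: "real set"
  assumes "countable Z"
  obtains v where "0 < v" "\<And>k::nat. v + real k \<notin> Z"
proof -
  have "countable (\<Union>k::nat. (\<lambda>a. a - real k) ` Z)" using assms by auto
  moreover have "uncountable {0<..<1::real}" by (simp add: uncountable_open_interval)
  ultimately obtain v where v: "v \<in> {0<..<1}" "v \<notin> (\<Union>k::nat. (\<lambda>a. a - real k) ` Z)"
    by (meson countable_subset subsetI)
  show ?thesis
  proof
    show "0 < v" using v by simp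
    show "v + real k \<notin> Z" for k
    proof
      assume "v + real k \<in> Z"
      then have "v \<in> (\<lambda>a. a - real k) ` Z" by (intro image_eqI[of _ _ "v + real k"]) auto
      with v(2) show False by blast
    qed
  qed
qed

theorem theorem1:
  fixes p s :: nat and \<psi> \<phi>\<^sub>1 \<phi>\<^sub>2 :: "real \<Rightarrow> complex"
  assumes "p > 0" and "s > 0"
    and "nonconstant_radial \<psi>" and "toeplitz_symbol (quasihom (- int s) \<psi>)"
    and "nonconstant_radial \<phi>\<^sub>1" and "toeplitz_symbol (quasihom (int p) \<phi>\<^sub>1)"
    and "nonconstant_radial \<phi>\<^sub>2" and "toeplitz_symbol (quasihom (int p) \<phi>\<^sub>2)"
    and "commuting (toeplitz (quasihom (int p) \<phi>\<^sub>1)) (toeplitz (quasihom (- int s) \<psi>))"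
    and "commuting (toeplitz (quasihom (int p) \<phi>\<^sub>2)) (toeplitz (quasihom (- int s) \<psi>))"
  shows "\<exists>c. AE r in lebesgue_on {0..<1}. \<phi>\<^sub>1 r = c * \<phi>\<^sub>2 r"
proof -
  \<comment> \<open>A nonconstant function is in particular not almost everywhere \<open>0\<close>;
    in this form the hypothesis reaches the zeros of the transforms.\<close>
  have ex: "\<exists>\<eta>'. \<eta>' \<in> borel_measurable borel \<and> (AE r in radius_measure. \<eta> r = \<eta>' r)
      \<and> toeplitz_symbol (quasihom k \<eta>') \<and> toeplitz (quasihom k \<eta>) = toeplitz (quasihom k \<eta>')
      \<and> integrable radius_measure \<eta>' \<and> \<not> (AE r in radius_measure. \<eta>' r = 0)"
    if c: "nonconstant_radial \<eta>" and t: "toeplitz_symbol (quasihom k \<eta>)" for \<eta> k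
  proof -
    obtain \<eta>' where \<eta>': "\<eta>' \<in> borel_measurable borel" "AE r in radius_measure. \<eta> r = \<eta>' r"
      using radial_function_AE_eq_borel c unfolding nonconstant_radial_def by metis
    have "\<not> (AE r in radius_measure. \<eta>' r = 0)"
    proof
      assume "AE r in radius_measure. \<eta>' r = 0"
      with \<eta>'(2) have "AE r in radius_measure. \<eta> r = 0" by eventually_elim simp
      with c show False unfolding nonconstant_radial_def AE_lebesgue_on_iff_radius by blast
    qed
    with \<eta>' toeplitz_quasihom_cong[OF \<eta>'(2,1) t] toeplitz_symbol_quasihom_cong[OF \<eta>'(2,1) t]
      quasihom_integrable_imp_radius_integrable[OF \<eta>'(1) quasihom_borel_integrable[OF \<eta>'(2,1) t]]
    show ?thesis by blast
  qed
  obtain q where q: "q \<in> borel_measurable borel" "toeplitz_symbol (quasihom (- int s) q)"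
      "toeplitz (quasihom (- int s) \<psi>) = toeplitz (quasihom (- int s) q)"
      "integrable radius_measure q" "\<not> (AE r in radius_measure. q r = 0)"
    using ex[OF assms(3,4)] by blast
  obtain f where f: "f \<in> borel_measurable borel" "AE r in radius_measure. \<phi>\<^sub>1 r = f r"
      "toeplitz_symbol (quasihom (int p) f)"
      "toeplitz (quasihom (int p) \<phi>\<^sub>1) = toeplitz (quasihom (int p) f)" "integrable radius_measure f"
    using ex[OF assms(5,6)] by blast
  obtain g where g: "g \<in> borel_measurable borel" "AE r in radius_measure. \<phi>\<^sub>2 r = g r"
      "toeplitz_symbol (quasihom (int p) g)"
      "toeplitz (quasihom (int p) \<phi>\<^sub>2) = toeplitz (quasihom (int p) g)" "integrable radius_measure g"
      "\<not> (AE r in radius_measure. g r = 0)"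
    using ex[OF assms(7,8)] by blast
  note idf = commuting_imp_mellin_identity_real[OF f(3,1,5) q(2,1,4) assms(9)[unfolded f(4) q(3)]]
  note idg = commuting_imp_mellin_identity_real[OF g(3,1,5) q(2,1,4) assms(10)[unfolded g(4) q(3)]]
  have one: "integrable radius_measure (\<lambda>_. 1 :: complex)" by simp
  have one_ne: "\<not> (AE r in radius_measure. (1 :: complex) = 0)"
  proof
    assume "AE r in radius_measure. (1 :: complex) = 0"
    then have "AE r in radius_measure. (1 :: complex) * of_real (r powr real (2 * 0)) = 0"
      by eventually_elim simp
    then have "mellin (\<lambda>_. 1) (real (2 * 0)) = 0"
      unfolding mellin_def by (rule integral_eq_zero_AE)
    then show False using mellin_one_of_nat[of 0] by simp
  qed
  \<comment> \<open>These are the transforms by which the recursion divides: those of \<psi> and of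
    \<open>1\<close> in each step, and that of the second symbol at the start.\<close>
  have "countable ({a. 0 < a \<and> mellin q a = 0} \<union> {a. 0 < a \<and> mellin (\<lambda>_. 1) a = 0} \<union> {a. 0 < a \<and> mellin g a = 0})"
    by (intro countable_Un countable_mellin_zeros q(4,5) g(5,6) one one_ne)
  then obtain v where v: "0 < v" and
    vk: "\<And>k::nat. v + real k \<notin> {a. 0 < a \<and> mellin q a = 0} \<union> {a. 0 < a \<and> mellin (\<lambda>_. 1) a = 0} \<union> {a. 0 < a \<and> mellin g a = 0}"
    by (rule exists_shift_avoiding_countable) blast
  have vpos: "0 < v + real k" for k using v by simp
  have nz: "mellin q (v + real k) \<noteq> 0" "mellin (\<lambda>_. 1) (v + real k) \<noteq> 0" "mellin g (v + real k) \<noteq> 0" for k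
    using vk[of k] vpos[of k] by auto
  \<comment> \<open>The ratio at the first point of the progression; the denominator is not
    \<open>0\<close> because \<open>v + p\<close> is an integer translate of
    \<open>v\<close>.\<close>
  define c where "c = mellin f (v + p) / mellin g (v + p)"
  have step: "mellin f (v + p + (2 * s) * real n) = c * mellin g (v + p + (2 * s) * real n)" for n
  proof (induction n)
    case 0
    show ?case using nz(3)[of p] by (simp add: c_def)
  next
    case (Suc n)
    \<comment> \<open>The recursion leads from \<open>p + V\<close> to \<open>2 * s + p + V\<close>.
      With \<open>V\<close> as the real argument of the identity, both symbols satisfy the same
      linear relation with coefficients \<alpha> and \<beta>.\<close>
    define V where "V = v + real (2 * s * n)"
    define \<alpha> where "\<alpha> = mellin q (s + V) * mellin (\<lambda>_. 1) (2 * s + 2 * p + V)"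
    define \<beta> where "\<beta> = mellin q (2 * p + s + V) * mellin (\<lambda>_. 1) V"
    have W: "2 * real p + real s + V = v + real (2 * p + s + 2 * s * n)" by (simp add: V_def)
    have "mellin q (2 * real p + real s + V) \<noteq> 0" unfolding W by (rule nz)
    moreover have "mellin (\<lambda>_. 1) V \<noteq> 0" unfolding V_def by (rule nz)
    ultimately have "\<beta> \<noteq> 0" unfolding \<beta>_def by simp
    have e: "v + p + (2 * s) * real n = p + V" "v + p + (2 * s) * real (Suc n) = 2 * s + p + V"
      by (simp_all add: V_def algebra_simps)
    have V: "0 < V" unfolding V_def by (rule vpos)
    have "\<beta> * mellin f (2 * s + p + V) = \<alpha> * mellin f (p + V)"
      using idf[OF V] by (simp add: \<alpha>_def \<beta>_def)
    also have "\<dots> = c * (\<alpha> * mellin g (p + V))" using Suc unfolding e by simp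
    also have "\<alpha> * mellin g (p + V) = \<beta> * mellin g (2 * s + p + V)"
      using idg[OF V] by (simp add: \<alpha>_def \<beta>_def)
    finally show ?case unfolding e using \<open>\<beta> \<noteq> 0\<close> by simp
  qed
  \<comment> \<open>Proportionality of the transforms along the progression from
    \<open>v + p\<close> with step \<open>2 * s\<close> says that the transform of the difference
    vanishes there.\<close>
  have "AE r in radius_measure. f r - c * g r = 0"
  proof (rule AE_eq_0_if_mellin_eq_0)
    show "integrable radius_measure (\<lambda>r. f r - c * g r)" using f(5) g(5) by simp
    show "0 < real (2 * s)" "0 \<le> v + real p" using assms(2) v by simp_all
    fix n :: nat
    define a where "a = v + real p + real (2 * s) * real n"
    have a: "0 \<le> a" using v by (simp add: a_def)
    have "mellin (\<lambda>r. f r - c * g r) a = mellin f a - c * mellin g a"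
      using mellin_integrable[OF f(5) a] mellin_integrable[OF g(5) a]
      unfolding mellin_def left_diff_distrib mult.assoc by simp
    also have "\<dots> = 0" using step[of n] by (simp add: a_def)
    finally show "mellin (\<lambda>r. f r - c * g r) (v + real p + real (2 * s) * real n) = 0" unfolding a_def .
  qed
  with f(2) g(2) have "AE r in radius_measure. \<phi>\<^sub>1 r = c * \<phi>\<^sub>2 r"
    by eventually_elim simp
  then show ?thesis unfolding AE_lebesgue_on_iff_radius by blast
qed

end
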